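(* Let $V$ be an $n$-graded vector space. Then: (1) $(M(V),[\ ,\ ]^{\Delta})$ is an $(n+1)$-graded Lie algebra. (2) If $\mu\in M^{(1,0,\dots,0)}(V)$, i.e. $\mu:V\times V\to V$ is bilinear of weight $0\in\mathbb Z^n$, then $\mu$ is an associative $n$-graded multiplication on $V$ if and only if $[\mu,\mu]^{\Delta}=0$.
   Context: All vector spaces are over a field $\mathbb K$ of characteristic $0$. For $x,y\in\mathbb Z^n$ put $\langle x,y\rangle=\sum_{i=1}^n x^iy^i$. An $n$-graded vector space is $V=\bigoplus_{x\in\mathbb Z^n}V^x$; elements of $V^x$ are homogeneous of (multi)degree $x$, and the degree of a homogeneous element $X$ (or $X_i$) is denoted $x$ (or $x_i$). An $n$-graded Lie algebra is an $n$-graded vector space with a bilinear bracket such that $[\mathcal E^x,\mathcal E^y]\subseteq\mathcal E^{x+y}$ and, for homogeneous elements, $[X,Y]=-(-1)^{\langle x,y\rangle}[Y,X]$ and $[X,[Y,Z]]=[[X,Y],Z]+(-1)^{\langle x,y\rangle}[Y,[X,Z]]$. For an $n$-graded vector space $V$ let $M(V)=\bigoplus_{(k,\kappa)\in\mathbb Z\times\mathbb Z^n}M^{(k,\kappa)}(V)$, where $M^{(k,\kappa)}(V)$ is the space of $(k+1)$-linear maps $K:V\times\dots\times V\to V$ with $K(V^{x_0}\times\dots\times V^{x_k})\subseteq V^{x_0+\dots+x_k+\kappa}$ ($k$ is the form degree, $\kappa$ the weight; $M^{(-1,\kappa)}(V)=V^\kappa$, and $M^{(k,\kappa)}(V)=0$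 for $k<-1$). For $K_i\in M^{(k_i,\kappa_i)}(V)$ and $X_l\in V^{x_l}$ define $j(K_1)K_2\in M^{(k_1+k_2,\kappa_1+\kappa_2)}(V)$ by $$(j(K_1)K_2)(X_0,\dots,X_{k_1+k_2})=\sum_{i=0}^{k_2}(-1)^{k_1i+\langle\kappa_1,\kappa_2+x_0+\dots+x_{i-1}\rangle}K_2(X_0,\dots,K_1(X_i,\dots,X_{i+k_1}),\dots,X_{k_1+k_2})$$ (so $j(K_1)K_2=0$ if $k_2=-1$), and $$[K_1,K_2]^{\Delta}=j(K_1)K_2-(-1)^{k_1k_2+\langle\kappa_1,\kappa_2\rangle}j(K_2)K_1.$$ The $(n+1)$-degree of an element of $M^{(k,\kappa)}(V)$ is $(k,\kappa)$. *)

theory Defs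
  imports Complex_Main "HOL-Library.Function_Algebras"
begin

(* Z^n as the integer sequences supported on {0..<n}, so that n = 0 is allowed and Z^n and
   Z^(n+1) live in one type; addition is the pointwise one of Function_Algebras. *)
definition degrees :: "nat \<Rightarrow> (nat \<Rightarrow> int) set"
  where "degrees n = {x. \<forall>i\<ge>n. x i = 0}"

definition pairing :: "nat \<Rightarrow> (nat \<Rightarrow> int) \<Rightarrow> (nat \<Rightarrow> int) \<Rightarrow> int"
  where "pairing n x y = (\<Sum>i<n. x i * y i)"

definition homogeneous_decomposition ::
  "nat \<Rightarrow> ((nat \<Rightarrow> int) \<Rightarrow> 'v::ab_group_add set) \<Rightarrow> ((nat \<Rightarrow> int) \<Rightarrow> 'v) \<Rightarrow> 'v \<Rightarrow> bool"
  where "homogeneous_decomposition n Vg c v \<longleftrightarrow>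
    finite {x. c x \<noteq> 0} \<and> {x. c x \<noteq> 0} \<subseteq> degrees n \<and> (\<forall>x\<in>degrees n. c x \<in> Vg x) \<and>
    v = (\<Sum>x | c x \<noteq> 0. c x)"

(* V is a subspace of the ambient type 'v and the internal direct sum of its subspaces Vg x,
   x in Z^n; the values of Vg outside degrees n are irrelevant. *)
locale graded_vector_space = vector_space scale
  for scale :: "'k::field_char_0 \<Rightarrow> 'v::ab_group_add \<Rightarrow> 'v" +
  fixes n :: nat and V :: "'v set" and Vg :: "(nat \<Rightarrow> int) \<Rightarrow> 'v set"
  assumes subspace_V: "subspace V"
    and subspace_Vg: "x \<in> degrees n \<Longrightarrow> subspace (Vg x)"
    and Vg_subset: "x \<in> degrees n \<Longrightarrow> Vg x \<subseteq> V"
    and direct_sum: "v \<in> V \<Longrightarrow> \<exists>!c. homogeneous_decomposition n Vg c v"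

locale graded_lie_algebra = graded_vector_space scale n E Eg
  for scale :: "'k::field_char_0 \<Rightarrow> 'e::ab_group_add \<Rightarrow> 'e"
    and n :: nat and E :: "'e set" and Eg :: "(nat \<Rightarrow> int) \<Rightarrow> 'e set" +
  fixes br :: "'e \<Rightarrow> 'e \<Rightarrow> 'e"
  assumes br_closed: "\<lbrakk>X \<in> E; Y \<in> E\<rbrakk> \<Longrightarrow> br X Y \<in> E"
    and br_add_left: "\<lbrakk>X \<in> E; X' \<in> E; Y \<in> E\<rbrakk> \<Longrightarrow> br (X + X') Y = br X Y + br X' Y"
    and br_add_right: "\<lbrakk>X \<in> E; Y \<in> E; Y' \<in> E\<rbrakk> \<Longrightarrow> br X (Y + Y') = br X Y + br X Y'"
    and br_scale_left: "\<lbrakk>X \<in> E; Y \<in> E\<rbrakk> \<Longrightarrow> br (scale c X) Y = scale c (br X Y)"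
    and br_scale_right: "\<lbrakk>X \<in> E; Y \<in> E\<rbrakk> \<Longrightarrow> br X (scale c Y) = scale c (br X Y)"
    and br_graded:
      "\<lbrakk>x \<in> degrees n; y \<in> degrees n; X \<in> Eg x; Y \<in> Eg y\<rbrakk> \<Longrightarrow> br X Y \<in> Eg (x + y)"
    and br_antisym:
      "\<lbrakk>x \<in> degrees n; y \<in> degrees n; X \<in> Eg x; Y \<in> Eg y\<rbrakk> \<Longrightarrow>
        br X Y = - scale ((-1) powi pairing n x y) (br Y X)"
    and br_jacobi:
      "\<lbrakk>x \<in> degrees n; y \<in> degrees n; z \<in> degrees n; X \<in> Eg x; Y \<in> Eg y; Z \<in> Eg z\<rbrakk> \<Longrightarrow>
        br X (br Y Z) = br (br X Y) Z + scale ((-1) powi pairing n x y) (br Y (br X Z))"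

definition homogeneous_args ::
  "nat \<Rightarrow> ((nat \<Rightarrow> int) \<Rightarrow> 'v set) \<Rightarrow> 'v list \<Rightarrow> (nat \<Rightarrow> int) list \<Rightarrow> bool"
  where "homogeneous_args n Vg Xs xs \<longleftrightarrow> list_all2 (\<lambda>X x. x \<in> degrees n \<and> X \<in> Vg x) Xs xs"

(* M^(k,kappa)(V) for V the whole type 'v. A (k+1)-linear map is a function on argument lists,
   normalised to 0 on lists of length different from k+1. For k = -1 the only relevant argument
   is [], giving V^kappa; for k < -1 only the zero function remains. *)
definition multilinear_maps ::
  "('k::field_char_0 \<Rightarrow> 'v::ab_group_add \<Rightarrow> 'v) \<Rightarrow> nat \<Rightarrow> ((nat \<Rightarrow> int) \<Rightarrow> 'v set) \<Rightarrow>
    int \<Rightarrow> (nat \<Rightarrow> int) \<Rightarrow> ('v list \<Rightarrow> 'v) set"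
  where "multilinear_maps scale n Vg k \<kappa> = {K.
    (\<forall>Xs. int (length Xs) \<noteq> k + 1 \<longrightarrow> K Xs = 0) \<and>
    (\<forall>Xs i X Y. int (length Xs) = k + 1 \<and> i < length Xs \<longrightarrow>
      K (Xs[i := X + Y]) = K (Xs[i := X]) + K (Xs[i := Y])) \<and>
    (\<forall>Xs i c X. int (length Xs) = k + 1 \<and> i < length Xs \<longrightarrow>
      K (Xs[i := scale c X]) = scale c (K (Xs[i := X]))) \<and>
    (\<forall>Xs xs. int (length Xs) = k + 1 \<and> homogeneous_args n Vg Xs xs \<longrightarrow>
      K Xs \<in> Vg (sum_list xs + \<kappa>))}"

(* The value of j(K1)K2 at homogeneous arguments Xs of degrees xs. *)
definition insertion_formula ::
  "('k::field_char_0 \<Rightarrow> 'v::ab_group_add \<Rightarrow> 'v) \<Rightarrow> nat \<Rightarrow>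
    int \<Rightarrow> (nat \<Rightarrow> int) \<Rightarrow> int \<Rightarrow> (nat \<Rightarrow> int) \<Rightarrow>
    ('v list \<Rightarrow> 'v) \<Rightarrow> ('v list \<Rightarrow> 'v) \<Rightarrow> 'v list \<Rightarrow> (nat \<Rightarrow> int) list \<Rightarrow> 'v"
  where "insertion_formula scale n k1 \<kappa>1 k2 \<kappa>2 K1 K2 Xs xs =
    (\<Sum>i<nat (k2 + 1).
      scale ((-1) powi (k1 * int i + pairing n \<kappa>1 (\<kappa>2 + sum_list (take i xs))))
        (K2 (take i Xs @ [K1 (take (nat (k1 + 1)) (drop i Xs))] @ drop (i + nat (k1 + 1)) Xs)))"

(* j(K1)K2: the formula fixes the values at homogeneous arguments only, and a multilinear map is
   determined by these. *)
definition insertion ::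
  "('k::field_char_0 \<Rightarrow> 'v::ab_group_add \<Rightarrow> 'v) \<Rightarrow> nat \<Rightarrow> ((nat \<Rightarrow> int) \<Rightarrow> 'v set) \<Rightarrow>
    int \<Rightarrow> (nat \<Rightarrow> int) \<Rightarrow> int \<Rightarrow> (nat \<Rightarrow> int) \<Rightarrow>
    ('v list \<Rightarrow> 'v) \<Rightarrow> ('v list \<Rightarrow> 'v) \<Rightarrow> 'v list \<Rightarrow> 'v"
  where "insertion scale n Vg k1 \<kappa>1 k2 \<kappa>2 K1 K2 =
    (THE L. L \<in> multilinear_maps scale n Vg (k1 + k2) (\<kappa>1 + \<kappa>2) \<and>
      (\<forall>Xs xs. int (length Xs) = k1 + k2 + 1 \<and> homogeneous_args n Vg Xs xs \<longrightarrow>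
        L Xs = insertion_formula scale n k1 \<kappa>1 k2 \<kappa>2 K1 K2 Xs xs))"

definition homogeneous_bracket ::
  "('k::field_char_0 \<Rightarrow> 'v::ab_group_add \<Rightarrow> 'v) \<Rightarrow> nat \<Rightarrow> ((nat \<Rightarrow> int) \<Rightarrow> 'v set) \<Rightarrow>
    int \<Rightarrow> (nat \<Rightarrow> int) \<Rightarrow> int \<Rightarrow> (nat \<Rightarrow> int) \<Rightarrow>
    ('v list \<Rightarrow> 'v) \<Rightarrow> ('v list \<Rightarrow> 'v) \<Rightarrow> 'v list \<Rightarrow> 'v"
  where "homogeneous_bracket scale n Vg k1 \<kappa>1 k2 \<kappa>2 K1 K2 = (\<lambda>Xs.
    insertion scale n Vg k1 \<kappa>1 k2 \<kappa>2 K1 K2 Xs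
    - scale ((-1) powi (k1 * k2 + pairing n \<kappa>1 \<kappa>2))
        (insertion scale n Vg k2 \<kappa>2 k1 \<kappa>1 K2 K1 Xs))"

(* M(V) as an external direct sum: finitely supported families indexed by a in Z^(n+1). The
   (n+1)-degree (k,kappa) is the sequence case_nat k kappa, so k = a 0 and kappa = a o Suc. *)
definition M_space ::
  "('k::field_char_0 \<Rightarrow> 'v::ab_group_add \<Rightarrow> 'v) \<Rightarrow> nat \<Rightarrow> ((nat \<Rightarrow> int) \<Rightarrow> 'v set) \<Rightarrow>
    ((nat \<Rightarrow> int) \<Rightarrow> 'v list \<Rightarrow> 'v) set"
  where "M_space scale n Vg = {F. finite {a. F a \<noteq> 0} \<and> {a. F a \<noteq> 0} \<subseteq> degrees (Suc n) \<and>
    (\<forall>a\<in>degrees (Suc n). F a \<in> multilinear_maps scale n Vg (a 0) (a \<circ> Suc))}"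

definition M_component ::
  "('k::field_char_0 \<Rightarrow> 'v::ab_group_add \<Rightarrow> 'v) \<Rightarrow> nat \<Rightarrow> ((nat \<Rightarrow> int) \<Rightarrow> 'v set) \<Rightarrow>
    (nat \<Rightarrow> int) \<Rightarrow> ((nat \<Rightarrow> int) \<Rightarrow> 'v list \<Rightarrow> 'v) set"
  where "M_component scale n Vg a = {F \<in> M_space scale n Vg. \<forall>b. b \<noteq> a \<longrightarrow> F b = 0}"

definition M_single ::
  "int \<Rightarrow> (nat \<Rightarrow> int) \<Rightarrow> ('v::ab_group_add list \<Rightarrow> 'v) \<Rightarrow> (nat \<Rightarrow> int) \<Rightarrow> 'v list \<Rightarrow> 'v"
  where "M_single k \<kappa> K = (\<lambda>a. if a = case_nat k \<kappa> then K else 0)"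

definition M_scale ::
  "('k::field_char_0 \<Rightarrow> 'v::ab_group_add \<Rightarrow> 'v) \<Rightarrow> 'k \<Rightarrow>
    ((nat \<Rightarrow> int) \<Rightarrow> 'v list \<Rightarrow> 'v) \<Rightarrow> (nat \<Rightarrow> int) \<Rightarrow> 'v list \<Rightarrow> 'v"
  where "M_scale scale c F = (\<lambda>a Xs. scale c (F a Xs))"

(* Biadditive extension of the bracket of homogeneous elements to all of M(V). *)
definition M_bracket ::
  "('k::field_char_0 \<Rightarrow> 'v::ab_group_add \<Rightarrow> 'v) \<Rightarrow> nat \<Rightarrow> ((nat \<Rightarrow> int) \<Rightarrow> 'v set) \<Rightarrow>
    ((nat \<Rightarrow> int) \<Rightarrow> 'v list \<Rightarrow> 'v) \<Rightarrow> ((nat \<Rightarrow> int) \<Rightarrow> 'v list \<Rightarrow> 'v) \<Rightarrow>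
    (nat \<Rightarrow> int) \<Rightarrow> 'v list \<Rightarrow> 'v"
  where "M_bracket scale n Vg F G = (\<lambda>d. \<Sum>(a, b) | F a \<noteq> 0 \<and> G b \<noteq> 0 \<and> a + b = d.
    homogeneous_bracket scale n Vg (a 0) (a \<circ> Suc) (b 0) (b \<circ> Suc) (F a) (G b))"

definition associative_graded_multiplication ::
  "('k::field_char_0 \<Rightarrow> 'v::ab_group_add \<Rightarrow> 'v) \<Rightarrow> nat \<Rightarrow> ((nat \<Rightarrow> int) \<Rightarrow> 'v set) \<Rightarrow>
    ('v \<Rightarrow> 'v \<Rightarrow> 'v) \<Rightarrow> bool"
  where "associative_graded_multiplication scale n Vg m \<longleftrightarrow>
    (\<forall>X X' Y. m (X + X') Y = m X Y + m X' Y) \<and>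
    (\<forall>X Y Y'. m X (Y + Y') = m X Y + m X Y') \<and>
    (\<forall>c X Y. m (scale c X) Y = scale c (m X Y)) \<and>
    (\<forall>c X Y. m X (scale c Y) = scale c (m X Y)) \<and>
    (\<forall>x\<in>degrees n. \<forall>y\<in>degrees n. \<forall>X\<in>Vg x. \<forall>Y\<in>Vg y. m X Y \<in> Vg (x + y)) \<and>
    (\<forall>X Y Z. m (m X Y) Z = m X (m Y Z))"

end

theory Submission
  imports Defs
begin

text \<open>
  The bracket is the graded commutator of the insertion product \<open>j(K)L\<close>, so its Jacobi identity follows
  once insertion is known to be a graded pre-Lie product, that is, once its associator
  \<open>j(K)j(L)M - j(j(K)L)M\<close> is graded symmetric in \<open>K\<close> and \<open>L\<close>. In \<open>j(K)j(L)M\<close> the operation \<open>K\<close> is inserted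
  either into \<open>L\<close> or into another slot of \<open>M\<close>. The summands of the first kind make up \<open>j(j(K)L)M\<close>
  (\<open>circ_circ_left\<close>). In those of the second kind \<open>K\<close> and \<open>L\<close> occupy two different slots of \<open>M\<close>, and the order
  of the two insertions matters only up to the sign of the two degrees (\<open>double_insertion_commute\<close>).
  This gives \<open>associator_symmetric\<close> and with it \<open>bracket_jacobi\<close>.

  The signs in the definition of \<open>j(K)L\<close> refer to the degrees of the arguments. To avoid carrying degrees
  through nested insertions, each such sign is written as the effect of a linear operator \<open>twist \<kappa>\<close> on the
  arguments, which is multiplication by \<open>(-1)\<close> to the power \<open>\<langle>\<kappa>,x\<rangle>\<close> on degree \<open>x\<close>. This expresses insertion
  by a formula valid for all arguments (\<open>circ\<close>); it is the right one because a multilinear map is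
  determined by its values at homogeneous arguments (\<open>insertion_eq_circ\<close>). Two properties of the twists
  suffice for the calculation: they compose additively in \<open>\<kappa>\<close>, and they commute with a multilinear map up
  to the sign of the two weights (\<open>twist_multilinear\<close>).

  For a multiplication \<open>\<mu>\<close> of weight 0, the bracket of \<open>\<mu>\<close> with itself is twice the usual associator
  of \<open>\<mu>\<close>, which gives the characterisation of associativity.
\<close>

section \<open>Signs and degrees\<close>

lemma pairing_commute: "pairing n x y = pairing n y x"
  by (simp add: pairing_def mult.commute)

lemma pairing_add_left: "pairing n (x + y) z = pairing n x z + pairing n y z"
  by (simp add: pairing_def algebra_simps sum.distrib)

lemma pairing_add_right: "pairing n x (y + z) = pairing n x y + pairing n x z"
  by (simp add: pairing_def algebra_simps sum.distrib)

lemma pairing_zero [simp]: "pairing n 0 x = 0" "pairing n x 0 = 0"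
  by (simp_all add: pairing_def)

lemma pairing_Suc: "pairing (Suc n) a b = a 0 * b 0 + pairing n (a \<circ> Suc) (b \<circ> Suc)"
  unfolding pairing_def by (subst sum.lessThan_Suc_shift) simp

lemma degrees_zero: "0 \<in> degrees n"
  by (simp add: degrees_def)

lemma degrees_add: "x \<in> degrees n \<Longrightarrow> y \<in> degrees n \<Longrightarrow> x + y \<in> degrees n"
  by (simp add: degrees_def)

lemma degrees_shift: "a \<in> degrees (Suc n) \<Longrightarrow> a \<circ> Suc \<in> degrees n"
  by (simp add: degrees_def)

lemma shift_add: "(a + b) \<circ> Suc = (a \<circ> Suc) + (b \<circ> Suc)" for a b :: "nat \<Rightarrow> int"
  by (simp add: fun_eq_iff)

lemma degrees_sum_list: "set xs \<subseteq> degrees n \<Longrightarrow> sum_list xs \<in> degrees n"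
  by (induction xs) (auto simp: degrees_zero degrees_add)

abbreviation sign :: "int \<Rightarrow> 'k::field"
  where "sign i \<equiv> (-1) powi i"

lemma sign_parity: "sign i = (if even i then 1 else (-1 :: 'k::field))"
  by (auto elim!: evenE oddE simp: power_int_add power_int_mult)

lemma sign_add: "sign (i + j) = (sign i * sign j :: 'k::field)"
  by (simp add: power_int_add)

lemma sign_cong: "even (i - j) \<Longrightarrow> sign i = (sign j :: 'k::field)"
  by (auto simp: sign_parity)

lemma sign_square: "sign i * sign i = (1 :: 'k::field)"
  by (simp add: sign_parity)

lemma sum_fun_apply: "(\<Sum>i\<in>I. f i) x = (\<Sum>i\<in>I. f i x)"
  by (induction I rule: infinite_finite_induct) auto

text \<open>
  When two operations are inserted into disjoint slots of a third one, the double sum runs over a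
  triangle; this exchanges the description by the later slot with the one by the earlier slot.
\<close>

lemma sum_triangle:
  "(\<Sum>i<Suc r. \<Sum>l<i. g l i) = (\<Sum>i<Suc r. \<Sum>t\<in>{i..<r}. g i (Suc t) :: 'a::comm_monoid_add)"
proof (induction r)
  case (Suc r)
  have "(\<Sum>i<Suc (Suc r). \<Sum>t\<in>{i..<Suc r}. g i (Suc t))
      = (\<Sum>i<Suc r. (\<Sum>t\<in>{i..<r}. g i (Suc t)) + g i (Suc r))"
    by simp
  then show ?case using Suc.IH by (simp add: sum.distrib)
qed simp

text \<open>
  After an operation of arity \<open>m\<close> has been inserted into slot \<open>i\<close> of one with slots \<open>0, \<dots>, r\<close>,
  a slot \<open>l\<close> of the composite lies before it, inside it, or after it.
\<close>

lemma sum_split_three: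
  fixes f :: "nat \<Rightarrow> 'a::comm_monoid_add"
  assumes "i \<le> r"
  shows "(\<Sum>l<m + r. f l) = (\<Sum>l<i. f l) + (\<Sum>j<m. f (i + j)) + (\<Sum>t\<in>{i..<r}. f (m + t))"
proof -
  have "(\<Sum>l<m + r. f l) = (\<Sum>l\<in>{0..<i}. f l) + (\<Sum>l\<in>{i..<i + m}. f l) + (\<Sum>l\<in>{i + m..<m + r}. f l)"
    using assms by (simp add: sum.atLeastLessThan_concat lessThan_atLeast0)
  moreover have "(\<Sum>l\<in>{i..<i + m}. f l) = (\<Sum>j<m. f (i + j))"
    using sum.shift_bounds_nat_ivl[of f 0 i m] by (simp add: lessThan_atLeast0 add.commute)
  moreover have "(\<Sum>l\<in>{i + m..<m + r}. f l) = (\<Sum>t\<in>{i..<r}. f (m + t))"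
    using sum.shift_bounds_nat_ivl[of f i m r] by (simp add: add.commute)
  ultimately show ?thesis by (simp add: lessThan_atLeast0)
qed

lemma split_list_at:
  assumes "m \<le> length Xs"
  obtains As Bs where "Xs = As @ Bs" "length As = m"
  using assms by (metis append_take_drop_id length_take min_absorb2)

section \<open>Homogeneous components and sign twists\<close>

locale graded_space = graded_vector_space scale n UNIV Vg
  for scale :: "'k::field_char_0 \<Rightarrow> 'v::ab_group_add \<Rightarrow> 'v" and n :: nat
    and Vg :: "(nat \<Rightarrow> int) \<Rightarrow> 'v set"
begin

abbreviation lin :: "('v \<Rightarrow> 'v) \<Rightarrow> bool"
  where "lin \<equiv> module_hom scale scale"

lemma linI:
  assumes "\<And>u v. f (u + v) = f u + f v" and "\<And>c v. f (scale c v) = scale c (f v)"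
  shows "lin f"
  using assms module_axioms by (simp add: module_hom_iff)

lemma lin_scale_fun: "lin f \<Longrightarrow> lin (\<lambda>v. scale c (f v))"
  by (simp add: module_hom_iff scale_right_distrib mult.commute)

lemma lin_add: "lin f \<Longrightarrow> f (u + v) = f u + f v"
  and lin_scale: "lin f \<Longrightarrow> f (scale c v) = scale c (f v)"
  and lin_zero: "lin f \<Longrightarrow> f 0 = 0"
  and lin_sum: "lin f \<Longrightarrow> f (\<Sum>i\<in>I. g i) = (\<Sum>i\<in>I. f (g i))"
  by (simp_all add: module_hom.add module_hom.scale module_hom.zero module_hom.sum)

lemma lin_sum_fun:
  assumes "\<And>i. i \<in> I \<Longrightarrow> lin (f i)"
  shows "lin (\<lambda>v. \<Sum>i\<in>I. f i v)"
proof (rule linI)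
  show "(\<Sum>i\<in>I. f i (u + v)) = (\<Sum>i\<in>I. f i u) + (\<Sum>i\<in>I. f i v)" for u v
    unfolding sum.distrib[symmetric] using assms lin_add by (intro sum.cong) auto
  show "(\<Sum>i\<in>I. f i (scale c v)) = scale c (\<Sum>i\<in>I. f i v)" for c v
    unfolding scale_sum_right using assms lin_scale by (intro sum.cong) auto
qed

definition component :: "'v \<Rightarrow> (nat \<Rightarrow> int) \<Rightarrow> 'v"
  where "component v = (THE c. homogeneous_decomposition n Vg c v)"

lemma decomposition: "homogeneous_decomposition n Vg (component v) v"
  unfolding component_def by (rule theI'[OF direct_sum[OF UNIV_I]])

lemma component_eqI: "homogeneous_decomposition n Vg c v \<Longrightarrow> component v = c"
  using decomposition direct_sum by blast

lemma finite_components: "finite {x. component v x \<noteq> 0}"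
  and component_outside: "x \<notin> degrees n \<Longrightarrow> component v x = 0"
  and component_in: "x \<in> degrees n \<Longrightarrow> component v x \<in> Vg x"
  and sum_components: "v = (\<Sum>x | component v x \<noteq> 0. component v x)"
  using decomposition[of v] unfolding homogeneous_decomposition_def by auto

lemma component_eq_sumI:
  assumes "finite A" "A \<subseteq> degrees n" "\<And>x. x \<in> degrees n \<Longrightarrow> c x \<in> Vg x" "\<And>x. x \<notin> A \<Longrightarrow> c x = 0"
    and "v = (\<Sum>x\<in>A. c x)"
  shows "component v = c"
proof (rule component_eqI)
  have sub: "{x. c x \<noteq> 0} \<subseteq> A" using assms(4) by auto
  moreover have "(\<Sum>x\<in>A. c x) = (\<Sum>x | c x \<noteq> 0. c x)"
    using assms(1) sub by (intro sum.mono_neutral_right) auto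
  ultimately show "homogeneous_decomposition n Vg c v"
    unfolding homogeneous_decomposition_def using assms finite_subset by auto
qed

lemma component_support_sum:
  assumes "finite A" "{x. component v x \<noteq> 0} \<subseteq> A"
  shows "v = (\<Sum>x\<in>A. component v x)"
  by (subst sum_components) (rule sum.mono_neutral_left, use assms in auto)

lemma component_add: "component (u + v) x = component u x + component v x"
proof -
  let ?A = "{x. component u x \<noteq> 0} \<union> {x. component v x \<noteq> 0}"
  have "component (u + v) = (\<lambda>x. component u x + component v x)"
  proof (rule component_eq_sumI[of ?A])
    show "u + v = (\<Sum>x\<in>?A. component u x + component v x)"
      unfolding sum.distrib
      by (intro arg_cong2[of _ _ _ _ "(+)"] component_support_sum) (auto simp: finite_components)
  qed (use finite_components component_outside component_in subspace_add[OF subspace_Vg] in auto)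
  then show ?thesis by simp
qed

lemma component_scale: "component (scale a v) x = scale a (component v x)"
proof -
  let ?A = "{x. component v x \<noteq> 0}"
  have "component (scale a v) = (\<lambda>x. scale a (component v x))"
  proof (rule component_eq_sumI[of ?A])
    show "scale a v = (\<Sum>x\<in>?A. scale a (component v x))"
      unfolding scale_sum_right[symmetric] using sum_components by simp
  qed (use finite_components component_outside component_in subspace_scale[OF subspace_Vg] in auto)
  then show ?thesis by simp
qed

lemma component_homogeneous:
  assumes "x \<in> degrees n" "v \<in> Vg x"
  shows "component v = (\<lambda>y. if y = x then v else 0)"
  by (rule component_eq_sumI[of "{x}"]) (use assms subspace_0[OF subspace_Vg] in auto)

lemma homogeneous_induct:
  assumes "P 0" and "\<And>u v. P u \<Longrightarrow> P v \<Longrightarrow> P (u + v)"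
    and "\<And>x v. x \<in> degrees n \<Longrightarrow> v \<in> Vg x \<Longrightarrow> P v"
  shows "P v"
proof -
  have "P (\<Sum>x\<in>A. component v x)" if "finite A" for A
    using that
  proof induction
    case (insert x A)
    then show ?case
      using assms component_outside component_in by (cases "x \<in> degrees n") auto
  qed (use assms in auto)
  then show ?thesis using sum_components finite_components by metis
qed

text \<open>
  The linear operator acting on degree \<open>x\<close> as \<open>(-1)\<close> to the power \<open>\<langle>\<kappa>,x\<rangle>\<close>. It turns the signs of
  the insertion formula, which depend on the degrees of the arguments, into an operation defined on all
  arguments.
\<close>

definition twist :: "(nat \<Rightarrow> int) \<Rightarrow> 'v \<Rightarrow> 'v"
  where "twist \<kappa> v = (\<Sum>x | component v x \<noteq> 0. scale (sign (pairing n \<kappa> x)) (component v x))"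

lemma twist_support_sum:
  assumes "finite A" "{x. component v x \<noteq> 0} \<subseteq> A"
  shows "twist \<kappa> v = (\<Sum>x\<in>A. scale (sign (pairing n \<kappa> x)) (component v x))"
  unfolding twist_def by (rule sum.mono_neutral_left) (use assms in auto)

lemma lin_twist: "lin (twist \<kappa>)"
proof (rule linI)
  fix u v
  let ?A = "{x. component u x \<noteq> 0} \<union> {x. component v x \<noteq> 0}"
  have fin: "finite ?A" using finite_components by auto
  have "twist \<kappa> w = (\<Sum>x\<in>?A. scale (sign (pairing n \<kappa> x)) (component w x))"
    if "w \<in> {u, v, u + v}" for w
    by (rule twist_support_sum[OF fin]) (use that in \<open>auto simp: component_add\<close>)
  then show "twist \<kappa> (u + v) = twist \<kappa> u + twist \<kappa> v"
    by (simp add: component_add scale_right_distrib sum.distrib)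
next
  fix a v
  have "twist \<kappa> (scale a v)
      = (\<Sum>x | component v x \<noteq> 0. scale (sign (pairing n \<kappa> x)) (component (scale a v) x))"
    by (rule twist_support_sum) (auto simp: finite_components component_scale)
  then show "twist \<kappa> (scale a v) = scale a (twist \<kappa> v)"
    by (simp add: component_scale twist_def scale_sum_right mult.commute)
qed

lemma twist_homogeneous:
  "x \<in> degrees n \<Longrightarrow> v \<in> Vg x \<Longrightarrow> twist \<kappa> v = scale (sign (pairing n \<kappa> x)) v"
  by (subst twist_support_sum[of "{x}"]) (auto simp: component_homogeneous)

lemma twist_twist: "twist \<kappa> (twist \<eta> v) = twist (\<kappa> + \<eta>) v"
proof (induction v rule: homogeneous_induct)
  case (3 x v)
  then show "twist \<kappa> (twist \<eta> v) = twist (\<kappa> + \<eta>) v"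
    by (simp add: twist_homogeneous lin_scale[OF lin_twist] pairing_add_left sign_add mult.commute)
qed (simp_all add: lin_add[OF lin_twist] lin_zero[OF lin_twist])

lemma twist_comp: "twist \<kappa> \<circ> twist \<eta> = twist (\<kappa> + \<eta>)"
  using twist_twist by (simp only: fun_eq_iff o_apply) simp

lemma twist_zero_weight: "twist 0 v = v"
  unfolding twist_def using sum_components[of v] by simp

section \<open>Multilinear maps on argument lists\<close>

text \<open>
  A slot is addressed by splitting the argument list around it, so that substituting into a slot is
  plain list concatenation.
\<close>

definition slotwise_linear :: "nat \<Rightarrow> ('v list \<Rightarrow> 'v) \<Rightarrow> bool"
  where "slotwise_linear m K \<longleftrightarrow>
    (\<forall>As Bs. Suc (length As + length Bs) = m \<longrightarrow> lin (\<lambda>Z. K (As @ Z # Bs)))"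

lemma slotwise_linearD:
  "slotwise_linear m K \<Longrightarrow> Suc (length As + length Bs) = m \<Longrightarrow> lin (\<lambda>Z. K (As @ Z # Bs))"
  by (simp add: slotwise_linear_def)

definition homogeneous :: "'v \<Rightarrow> bool"
  where "homogeneous v \<longleftrightarrow> (\<exists>x\<in>degrees n. v \<in> Vg x)"

lemma homogeneous_args_exist:
  "(\<exists>xs. homogeneous_args n Vg Xs xs) \<longleftrightarrow> (\<forall>X\<in>set Xs. homogeneous X)"
proof (induction Xs)
  case (Cons X Xs)
  then show ?case
    by (auto simp: homogeneous_args_def homogeneous_def list_all2_Cons1)
qed (auto simp: homogeneous_args_def)

lemma homogeneous_args_degrees: "homogeneous_args n Vg Xs xs \<Longrightarrow> set xs \<subseteq> degrees n"
  unfolding homogeneous_args_def by (force simp: list_all2_conv_all_nth in_set_conv_nth)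

text \<open>
  Every vector is a sum of homogeneous ones, so the arguments can be made homogeneous one at a time,
  from left to right.
\<close>

lemma multilinear_ext:
  assumes K: "slotwise_linear m K" and L: "slotwise_linear m L"
    and eq: "\<And>Xs xs. length Xs = m \<Longrightarrow> homogeneous_args n Vg Xs xs \<Longrightarrow> K Xs = L Xs"
    and len: "length Xs = m"
  shows "K Xs = L Xs"
proof -
  have "K (As @ Bs) = L (As @ Bs)"
    if "length (As @ Bs) = m" "\<forall>X\<in>set As. homogeneous X" for As Bs
    using that
  proof (induction Bs arbitrary: As)
    case Nil
    then have "length As = m" "\<exists>xs. homogeneous_args n Vg As xs"
      unfolding homogeneous_args_exist by auto
    then show ?case using eq by auto
  next
    case (Cons B Bs)
    note linK = slotwise_linearD[OF K, of As Bs] and linL = slotwise_linearD[OF L, of As Bs]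
    show ?case
    proof (induction B rule: homogeneous_induct)
      case 1
      show ?case using lin_zero[OF linK] lin_zero[OF linL] Cons.prems by simp
    next
      case (2 u v)
      then show ?case using lin_add[OF linK] lin_add[OF linL] Cons.prems by simp
    next
      case (3 x v)
      then show ?case using Cons.IH[of "As @ [v]"] Cons.prems by (auto simp: homogeneous_def)
    qed
  qed
  from this[of "[]"] show ?thesis using len by simp
qed

lemma multilinear_maps_iff:
  "K \<in> multilinear_maps scale n Vg k \<kappa> \<longleftrightarrow>
    (\<forall>Xs. int (length Xs) \<noteq> k + 1 \<longrightarrow> K Xs = 0) \<and> slotwise_linear (nat (k + 1)) K \<and>
    (\<forall>Xs xs. int (length Xs) = k + 1 \<and> homogeneous_args n Vg Xs xs \<longrightarrow>
      K Xs \<in> Vg (sum_list xs + \<kappa>))"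
proof -
  have "slotwise_linear (nat (k + 1)) K \<longleftrightarrow>
    (\<forall>Xs i X Y. int (length Xs) = k + 1 \<and> i < length Xs \<longrightarrow>
      K (Xs[i := X + Y]) = K (Xs[i := X]) + K (Xs[i := Y])) \<and>
    (\<forall>Xs i c X. int (length Xs) = k + 1 \<and> i < length Xs \<longrightarrow>
      K (Xs[i := scale c X]) = scale c (K (Xs[i := X])))" (is "?L \<longleftrightarrow> ?A \<and> ?S")
  proof (intro iffI conjI allI impI)
    fix Xs :: "'v list" and i assume K: ?L and Xs: "int (length Xs) = k + 1 \<and> i < length Xs"
    then have "lin (\<lambda>Z. K (take i Xs @ Z # drop (Suc i) Xs))"
      by (intro slotwise_linearD[OF K]) auto
    then have *: "lin (\<lambda>Z. K (Xs[i := Z]))"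
      using Xs by (simp add: upd_conv_take_nth_drop)
    show "K (Xs[i := X + Y]) = K (Xs[i := X]) + K (Xs[i := Y])" for X Y
      using lin_add[OF *] .
    show "K (Xs[i := scale c X]) = scale c (K (Xs[i := X]))" for c X
      using lin_scale[OF *] .
  next
    assume *: "?A \<and> ?S"
    show ?L
      unfolding slotwise_linear_def
    proof (intro allI impI linI)
      fix As Bs :: "'v list" assume "Suc (length As + length Bs) = nat (k + 1)"
      then have "int (length (As @ 0 # Bs)) = k + 1 \<and> length As < length (As @ 0 # Bs)" by auto
      note A = conjunct1[OF *, rule_format, OF this] and S = conjunct2[OF *, rule_format, OF this]
      show "K (As @ (X + Y) # Bs) = K (As @ X # Bs) + K (As @ Y # Bs)" for X Y
        using A[of X Y] by simp
      show "K (As @ scale c X # Bs) = scale c (K (As @ X # Bs))" for c X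
        using S[of c X] by simp
    qed
  qed
  then show ?thesis unfolding multilinear_maps_def by auto
qed

context
  fixes K k \<kappa> assumes K: "K \<in> multilinear_maps scale n Vg k \<kappa>"
begin

lemma multilinear_wrong_length: "int (length Xs) \<noteq> k + 1 \<Longrightarrow> K Xs = 0"
  and multilinear_slotwise: "slotwise_linear (nat (k + 1)) K"
  and multilinear_degree:
    "int (length Xs) = k + 1 \<Longrightarrow> homogeneous_args n Vg Xs xs \<Longrightarrow> K Xs \<in> Vg (sum_list xs + \<kappa>)"
  using K unfolding multilinear_maps_iff by auto

lemma multilinear_low: "k < -1 \<Longrightarrow> K = 0"
  using multilinear_wrong_length by (force simp: fun_eq_iff)

text \<open>
  On lists of the wrong length \<open>K\<close> vanishes, so it is linear in every slot for lists of any length.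
\<close>

lemma multilinear_slot: "lin (\<lambda>Z. K (As @ Z # Bs))"
proof (cases "int (length As + length Bs) = k")
  case True
  then show ?thesis by (intro slotwise_linearD[OF multilinear_slotwise]) auto
next
  case False
  then have "K (As @ Z # Bs) = 0" for Z by (intro multilinear_wrong_length) auto
  then show ?thesis by (simp add: linI)
qed

lemma multilinear_zero_arg: "K (As @ 0 # Bs) = 0"
  using lin_zero[OF multilinear_slot] .

lemma multilinear_twist_prefix:
  assumes "homogeneous_args n Vg As as" "int (length (Ps @ As @ Bs)) = k + 1"
  shows "K (Ps @ map (twist \<eta>) As @ Bs) = scale (sign (pairing n \<eta> (sum_list as))) (K (Ps @ As @ Bs))"
  using assms
proof (induction As arbitrary: as Ps)
  case Nil
  then have "as = []" by (simp add: homogeneous_args_def)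
  then show "K (Ps @ map (twist \<eta>) [] @ Bs) = scale (sign (pairing n \<eta> (sum_list as))) (K (Ps @ [] @ Bs))"
    by simp
next
  case (Cons A As)
  then obtain a as' where as: "as = a # as'" "a \<in> degrees n" "A \<in> Vg a" "homogeneous_args n Vg As as'"
    by (auto simp: homogeneous_args_def list_all2_Cons1)
  have "K (Ps @ twist \<eta> A # map (twist \<eta>) As @ Bs)
      = scale (sign (pairing n \<eta> a)) (K (Ps @ A # map (twist \<eta>) As @ Bs))"
    unfolding twist_homogeneous[OF as(2,3)]
    by (rule lin_scale[OF multilinear_slot])
  with Cons.IH[OF as(4), of "Ps @ [A]"] Cons.prems
  show "K (Ps @ map (twist \<eta>) (A # As) @ Bs)
      = scale (sign (pairing n \<eta> (sum_list as))) (K (Ps @ (A # As) @ Bs))"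
    by (simp add: as(1) pairing_add_right sign_add)
qed

text \<open>
  Both sides are multilinear, so homogeneous arguments suffice; there \<open>K\<close> adds \<open>\<kappa>\<close> to the total
  degree of the arguments. This is where moving an operation past \<open>K\<close> produces the sign of the
  two weights.
\<close>

lemma twist_multilinear:
  assumes \<kappa>: "\<kappa> \<in> degrees n"
  shows "twist \<eta> (K Xs) = scale (sign (pairing n \<eta> \<kappa>)) (K (map (twist \<eta>) Xs))"
proof (cases "int (length Xs) = k + 1")
  case True
  show ?thesis
  proof (rule multilinear_ext[where m = "nat (k + 1)" and K = "\<lambda>Xs. twist \<eta> (K Xs)"
        and L = "\<lambda>Xs. scale (sign (pairing n \<eta> \<kappa>)) (K (map (twist \<eta>) Xs))"])
    show "slotwise_linear (nat (k + 1)) (\<lambda>Xs. twist \<eta> (K Xs))"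
      unfolding slotwise_linear_def
    proof (intro allI impI)
      fix As Bs :: "'v list"
      from module_hom_compose[OF multilinear_slot lin_twist] show "lin (\<lambda>Z. twist \<eta> (K (As @ Z # Bs)))"
        by (simp add: o_def)
    qed
    show "slotwise_linear (nat (k + 1)) (\<lambda>Xs. scale (sign (pairing n \<eta> \<kappa>)) (K (map (twist \<eta>) Xs)))"
      unfolding slotwise_linear_def
    proof (intro allI impI)
      fix As Bs :: "'v list"
      from module_hom_compose[OF lin_twist lin_scale_fun[OF multilinear_slot]]
      show "lin (\<lambda>Z. scale (sign (pairing n \<eta> \<kappa>)) (K (map (twist \<eta>) (As @ Z # Bs))))"
        by (simp add: o_def)
    qed
  next
    fix Xs xs assume len: "length Xs = nat (k + 1)" and hom: "homogeneous_args n Vg Xs xs"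
    have deg: "sum_list xs + \<kappa> \<in> degrees n"
      using \<kappa> homogeneous_args_degrees[OF hom] by (intro degrees_add degrees_sum_list)
    show "twist \<eta> (K Xs) = scale (sign (pairing n \<eta> \<kappa>)) (K (map (twist \<eta>) Xs))"
    proof (cases "k < -1")
      case True
      then show ?thesis using multilinear_low by (simp add: lin_zero[OF lin_twist])
    next
      case False
      then have len': "int (length Xs) = k + 1" using len by simp
      then have "K Xs \<in> Vg (sum_list xs + \<kappa>)" using hom by (rule multilinear_degree)
      with deg multilinear_twist_prefix[OF hom, of "[]" "[]"] len' show ?thesis
        by (simp add: twist_homogeneous pairing_add_right sign_add mult.commute)
    qed
  qed (use True in simp)
next
  case False
  then show ?thesis using multilinear_wrong_length by (simp add: lin_zero[OF lin_twist])
qed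

end

section \<open>Insertion as an explicit multilinear map\<close>

abbreviation weight :: "(nat \<Rightarrow> int) \<Rightarrow> nat \<Rightarrow> int"
  where "weight a \<equiv> a \<circ> Suc"

abbreviation arity :: "(nat \<Rightarrow> int) \<Rightarrow> nat"
  where "arity a \<equiv> nat (a 0 + 1)"

abbreviation maps :: "(nat \<Rightarrow> int) \<Rightarrow> ('v list \<Rightarrow> 'v) set"
  where "maps a \<equiv> multilinear_maps scale n Vg (a 0) (weight a)"

text \<open>
  \<open>K\<close> is inserted into slot \<open>i\<close> of \<open>L\<close>; the weight of \<open>K\<close> is moved past the first \<open>i\<close> arguments by
  twisting them. From here on operations carry their full degree \<open>a\<close>, with form degree \<open>a 0\<close> and weight
  \<open>a \<circ> Suc\<close>.
\<close>

definition plug :: "(nat \<Rightarrow> int) \<Rightarrow> ('v list \<Rightarrow> 'v) \<Rightarrow> nat \<Rightarrow> ('v list \<Rightarrow> 'v) \<Rightarrow> 'v list \<Rightarrow> 'v"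
  where "plug a K i L Xs =
    L (map (twist (weight a)) (take i Xs) @ K (take (arity a) (drop i Xs)) # drop (i + arity a) Xs)"

text \<open>
  The operation \<open>j(K)L\<close>, given at arbitrary arguments.
\<close>

definition circ ::
  "(nat \<Rightarrow> int) \<Rightarrow> (nat \<Rightarrow> int) \<Rightarrow> ('v list \<Rightarrow> 'v) \<Rightarrow> ('v list \<Rightarrow> 'v) \<Rightarrow> 'v list \<Rightarrow> 'v"
  where "circ a b K L Xs = (if int (length Xs) = a 0 + b 0 + 1 then
    \<Sum>i<arity b. scale (sign (a 0 * int i + pairing n (weight a) (weight b))) (plug a K i L Xs) else 0)"

lemma plug_zero: "L \<in> maps b \<Longrightarrow> plug a 0 i L Xs = 0" "plug a K i 0 Xs = 0"
  by (simp_all add: plug_def multilinear_zero_arg)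

lemma circ_zero: "L \<in> maps b \<Longrightarrow> circ a b 0 L = 0" "circ a b K 0 = 0"
  by (simp_all add: fun_eq_iff circ_def plug_zero)

lemma circ_wrong_length: "int (length Xs) \<noteq> a 0 + b 0 + 1 \<Longrightarrow> circ a b K L Xs = 0"
  by (simp add: circ_def)

text \<open>
  The varying argument is twisted and passed to \<open>L\<close>, or passed to \<open>K\<close> and then to \<open>L\<close>, or passed
  to \<open>L\<close> unchanged, according to its position relative to the inserted operation.
\<close>

lemma slotwise_linear_plug:
  assumes K: "K \<in> maps a" and L: "L \<in> maps b" and a: "a 0 \<ge> -1" and i: "i < arity b"
  shows "slotwise_linear (nat (a 0 + b 0 + 1)) (plug a K i L)"
  unfolding slotwise_linear_def
proof (intro allI impI)
  fix As Bs :: "'v list"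
  assume len: "Suc (length As + length Bs) = nat (a 0 + b 0 + 1)"
  let ?q = "length As" and ?m = "arity a" and ?\<theta> = "twist (weight a)"
  consider (left) "?q < i" | (middle) "i \<le> ?q" "?q < i + ?m" | (right) "i + ?m \<le> ?q"
    by linarith
  then show "lin (\<lambda>Z. plug a K i L (As @ Z # Bs))"
  proof cases
    case left
    then obtain d where d: "i = Suc (?q + d)" using less_iff_Suc_add by auto
    have "plug a K i L (As @ Z # Bs) = L (map ?\<theta> As @ ?\<theta> Z #
        (map ?\<theta> (take d Bs) @ K (take ?m (drop d Bs)) # drop (d + ?m) Bs))" for Z
      by (simp add: plug_def d)
    then show ?thesis
      using module_hom_compose[OF lin_twist multilinear_slot[OF L]] by (simp add: o_def)
  next
    case middle
    then obtain d where d: "?m = Suc (?q - i + d)"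
      by (metis add_diff_inverse_nat less_diff_conv2 less_iff_Suc_add not_less add.commute)
    have "plug a K i L (As @ Z # Bs) = L (map ?\<theta> (take i As) @
        K (drop i As @ Z # take d Bs) # drop d Bs)" for Z
      using middle by (simp add: plug_def d)
    then show ?thesis
      using module_hom_compose[OF multilinear_slot[OF K] multilinear_slot[OF L]]
      by (simp add: o_def)
  next
    case right
    have "plug a K i L (As @ Z # Bs) = L ((map ?\<theta> (take i As) @
        K (take ?m (drop i As)) # drop (i + ?m) As) @ Z # Bs)" for Z
      using right by (simp add: plug_def)
    then show ?thesis using multilinear_slot[OF L] by presburger
  qed
qed

text \<open>
  At homogeneous arguments the twists are scalars and come out of \<open>L\<close> by multilinearity.
\<close>

lemma circ_homogeneous:
  assumes K: "K \<in> maps a" and L: "L \<in> maps b"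
    and len: "int (length Xs) = a 0 + b 0 + 1" and hom: "homogeneous_args n Vg Xs xs"
  shows "circ a b K L Xs = insertion_formula scale n (a 0) (weight a) (b 0) (weight b) K L Xs xs"
proof (cases "a 0 < -1")
  case True
  then have "K = 0" using multilinear_low[OF K] by simp
  then show ?thesis
    using L multilinear_zero_arg[OF L] by (simp add: circ_zero insertion_formula_def)
next
  case False
  have "scale (sign (a 0 * int i + pairing n (weight a) (weight b))) (plug a K i L Xs)
      = scale (sign (a 0 * int i + pairing n (weight a) (weight b + sum_list (take i xs))))
          (L (take i Xs @ [K (take (arity a) (drop i Xs))] @ drop (i + arity a) Xs))"
    if i: "i < arity b" for i
  proof -
    have "homogeneous_args n Vg (take i Xs) (take i xs)"
      using hom unfolding homogeneous_args_def by (rule list_all2_takeI)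
    then have "plug a K i L Xs = scale (sign (pairing n (weight a) (sum_list (take i xs))))
        (L (take i Xs @ [K (take (arity a) (drop i Xs))] @ drop (i + arity a) Xs))"
      using multilinear_twist_prefix[OF L, of "take i Xs" "take i xs" "[]"
          "K (take (arity a) (drop i Xs)) # drop (i + arity a) Xs" "weight a"] len i False
      by (simp add: plug_def)
    then show ?thesis by (simp add: sign_add pairing_add_right mult.assoc)
  qed
  then show ?thesis unfolding circ_def insertion_formula_def using len by simp
qed

lemma insertion_formula_degree:
  assumes K: "K \<in> maps a" and L: "L \<in> maps b" and a: "a \<in> degrees (Suc n)" and b: "b \<in> degrees (Suc n)"
    and len: "int (length Xs) = a 0 + b 0 + 1" and hom: "homogeneous_args n Vg Xs xs"
  shows "insertion_formula scale n (a 0) (weight a) (b 0) (weight b) K L Xs xs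
    \<in> Vg (sum_list xs + (weight a + weight b))" (is "_ \<in> Vg ?d")
proof -
  have deg: "?d \<in> degrees n"
    using homogeneous_args_degrees[OF hom] a b
    by (intro degrees_add degrees_sum_list degrees_shift)
  have "L (take i Xs @ [K (take (arity a) (drop i Xs))] @ drop (i + arity a) Xs) \<in> Vg ?d"
    (is "L ?Ys \<in> _") if i: "i < arity b" for i
  proof (cases "a 0 < -1")
    case True
    then have "K = 0" using multilinear_low[OF K] by simp
    then show ?thesis
      using multilinear_zero_arg[OF L] subspace_0[OF subspace_Vg[OF deg]] by simp
  next
    case False
    let ?m = "arity a"
    let ?ys = "take i xs @ [sum_list (take ?m (drop i xs)) + weight a] @ drop (i + ?m) xs"
    have mid: "homogeneous_args n Vg (take ?m (drop i Xs)) (take ?m (drop i xs))"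
      and pre: "homogeneous_args n Vg (take i Xs) (take i xs)"
      and post: "homogeneous_args n Vg (drop (i + ?m) Xs) (drop (i + ?m) xs)"
      using hom unfolding homogeneous_args_def by (auto intro: list_all2_takeI list_all2_dropI)
    have "K (take ?m (drop i Xs)) \<in> Vg (sum_list (take ?m (drop i xs)) + weight a)"
      by (rule multilinear_degree[OF K _ mid]) (use len i False in auto)
    moreover have "sum_list (take ?m (drop i xs)) + weight a \<in> degrees n"
      using homogeneous_args_degrees[OF mid] a
      by (intro degrees_add degrees_sum_list degrees_shift)
    ultimately have "homogeneous_args n Vg ?Ys ?ys"
      using pre post unfolding homogeneous_args_def by (intro list_all2_appendI) auto
    then have "L ?Ys \<in> Vg (sum_list ?ys + weight b)"
      by (rule multilinear_degree[OF L, rotated]) (use len i False in auto)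
    moreover have "sum_list xs
        = sum_list (take i xs) + (sum_list (take ?m (drop i xs)) + sum_list (drop (i + ?m) xs))"
      unfolding sum_list_append[symmetric] by (metis append_take_drop_id drop_drop add.commute)
    ultimately show ?thesis by (simp add: add_ac)
  qed
  then show ?thesis
    unfolding insertion_formula_def
    by (intro subspace_sum[OF subspace_Vg[OF deg]] subspace_scale[OF subspace_Vg[OF deg]]) simp
qed

lemma circ_in_maps:
  assumes K: "K \<in> maps a" and L: "L \<in> maps b" and a: "a \<in> degrees (Suc n)" and b: "b \<in> degrees (Suc n)"
  shows "circ a b K L \<in> maps (a + b)"
  unfolding multilinear_maps_iff plus_fun_apply[of a b 0] shift_add
proof (intro conjI allI impI)
  show "circ a b K L Xs = 0" if "int (length Xs) \<noteq> a 0 + b 0 + 1" for Xs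
    using that by (rule circ_wrong_length)
  show "circ a b K L Xs \<in> Vg (sum_list xs + (weight a + weight b))"
    if "int (length Xs) = a 0 + b 0 + 1 \<and> homogeneous_args n Vg Xs xs" for Xs xs
    using that circ_homogeneous[OF K L, of Xs xs] insertion_formula_degree[OF K L a b, of Xs xs] by simp
  show "slotwise_linear (nat (a 0 + b 0 + 1)) (circ a b K L)"
  proof (cases "a 0 < -1")
    case True
    then have "circ a b K L = 0" using multilinear_low[OF K] circ_zero(1)[OF L] by simp
    then show ?thesis by (simp add: slotwise_linear_def linI)
  next
    case False
    show ?thesis
      unfolding slotwise_linear_def
    proof (intro allI impI)
      fix As Bs :: "'v list" assume len: "Suc (length As + length Bs) = nat (a 0 + b 0 + 1)"
      have "lin (\<lambda>Z. plug a K i L (As @ Z # Bs))" if "i < arity b" for i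
        using slotwise_linearD[OF slotwise_linear_plug[OF K L _ that] len] False by simp
      then have "lin (\<lambda>Z. \<Sum>i<arity b. scale (sign (a 0 * int i + pairing n (weight a) (weight b)))
          (plug a K i L (As @ Z # Bs)))"
        by (intro lin_sum_fun lin_scale_fun) simp
      moreover have "int (length (As @ Z # Bs)) = a 0 + b 0 + 1" for Z
        using len by auto
      ultimately show "lin (\<lambda>Z. circ a b K L (As @ Z # Bs))"
        unfolding circ_def by simp
    qed
  qed
qed

text \<open>
  The description in the definition of insertion determines a multilinear map by its values at homogeneous
  arguments; \<open>circ\<close> is multilinear and has these values.
\<close>

lemma insertion_eq_circ:
  assumes K: "K \<in> maps a" and L: "L \<in> maps b" and a: "a \<in> degrees (Suc n)" and b: "b \<in> degrees (Suc n)"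
  shows "insertion scale n Vg (a 0) (weight a) (b 0) (weight b) K L = circ a b K L"
  unfolding insertion_def
proof (rule the_equality)
  note mem = circ_in_maps[OF K L a b, unfolded plus_fun_apply[of a b 0] shift_add]
  show "circ a b K L \<in> multilinear_maps scale n Vg (a 0 + b 0) (weight a + weight b) \<and>
    (\<forall>Xs xs. int (length Xs) = a 0 + b 0 + 1 \<and> homogeneous_args n Vg Xs xs \<longrightarrow>
      circ a b K L Xs = insertion_formula scale n (a 0) (weight a) (b 0) (weight b) K L Xs xs)"
    using mem circ_homogeneous[OF K L] by blast
  fix M
  assume M: "M \<in> multilinear_maps scale n Vg (a 0 + b 0) (weight a + weight b) \<and>
    (\<forall>Xs xs. int (length Xs) = a 0 + b 0 + 1 \<and> homogeneous_args n Vg Xs xs \<longrightarrow>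
      M Xs = insertion_formula scale n (a 0) (weight a) (b 0) (weight b) K L Xs xs)"
  show "M = circ a b K L"
  proof
    fix Xs
    show "M Xs = circ a b K L Xs"
    proof (cases "int (length Xs) = a 0 + b 0 + 1")
      case True
      show ?thesis
        by (rule multilinear_ext[OF multilinear_slotwise[OF conjunct1[OF M]] multilinear_slotwise[OF mem]])
          (use M True circ_homogeneous[OF K L] in auto)
    next
      case False
      then show ?thesis
        using multilinear_wrong_length[OF conjunct1[OF M]] circ_wrong_length by simp
    qed
  qed
qed

lemma circ_add_left:
  assumes "L \<in> maps b"
  shows "circ a b (K + K') L = circ a b K L + circ a b K' L"
proof -
  have "plug a (K + K') i L Xs = plug a K i L Xs + plug a K' i L Xs" for i Xs
    by (simp add: plug_def lin_add[OF multilinear_slot[OF assms]])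
  then show ?thesis by (simp add: fun_eq_iff circ_def scale_right_distrib sum.distrib)
qed

lemma circ_scale_left:
  assumes "L \<in> maps b"
  shows "circ a b (\<lambda>Xs. scale c (K Xs)) L = (\<lambda>Xs. scale c (circ a b K L Xs))"
proof -
  have "plug a (\<lambda>Xs. scale c (K Xs)) i L Xs = scale c (plug a K i L Xs)" for i Xs
    by (simp add: plug_def lin_scale[OF multilinear_slot[OF assms]])
  then show ?thesis by (simp add: fun_eq_iff circ_def scale_sum_right mult.commute)
qed

lemma circ_add_right: "circ a b K (L + L') = circ a b K L + circ a b K L'"
  by (simp add: fun_eq_iff circ_def plug_def scale_right_distrib sum.distrib)

lemma circ_scale_right: "circ a b K (\<lambda>Xs. scale c (L Xs)) = (\<lambda>Xs. scale c (circ a b K L Xs))"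
  by (simp add: fun_eq_iff circ_def plug_def scale_sum_right mult.commute)

section \<open>The associator of insertion\<close>

text \<open>
  Inserting \<open>K\<close> into a slot of the composite that belongs to \<open>L\<close> is inserting it into \<open>L\<close> first,
  because the twists of the two weights compose to the twist of their sum.
\<close>

lemma plug_nested:
  assumes "length As = i" "length Bs = j" "length Cs = arity a" "length Bs + 1 + length Ds = arity b"
  shows "plug a K (i + j) (plug b L i M) (As @ Bs @ Cs @ Ds @ Es)
    = M (map (twist (weight (a + b))) As @ plug a K j L (Bs @ Cs @ Ds) # Es)"
proof -
  have "arity b = Suc (length Bs + length Ds)" using assms(4) by simp
  then show ?thesis
    using assms(1-3) by (simp add: plug_def twist_comp shift_add add.commute)
qed

text \<open>
  Insertions into different slots of \<open>M\<close> commute up to sign. If \<open>K\<close> stands before \<open>L\<close>, the twist by the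
  weight of \<open>L\<close> acts on the value of \<open>K\<close> when \<open>L\<close> is inserted into \<open>M\<close> first, and on the arguments
  of \<open>K\<close> when \<open>K\<close> is. In the composite with \<open>K\<close>, the slot of \<open>L\<close> is shifted by the arity of \<open>K\<close> minus one.
\<close>

lemma plug_disjoint:
  assumes K: "K \<in> maps a" and M: "M \<in> maps c" and a: "a \<in> degrees (Suc n)"
    and len: "length As = l" "length Bs = arity a" "length Cs = p" "length Ds = arity b"
  shows "plug a K l (plug b L (l + 1 + p) M) (As @ Bs @ Cs @ Ds @ Es)
    = scale (sign (pairing n (weight a) (weight b)))
        (plug b L (l + arity a + p) (plug a K l M) (As @ Bs @ Cs @ Ds @ Es))"
proof -
  let ?\<theta> = "twist (weight b)"
  have "plug a K l (plug b L (l + 1 + p) M) (As @ Bs @ Cs @ Ds @ Es)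
      = M (map (twist (weight (a + b))) As @ ?\<theta> (K Bs) # (map ?\<theta> Cs @ L Ds # Es))"
    using len by (simp add: plug_def twist_comp shift_add add.commute)
  also have "\<dots> = scale (sign (pairing n (weight a) (weight b)))
      (M (map (twist (weight (a + b))) As @ K (map ?\<theta> Bs) # (map ?\<theta> Cs @ L Ds # Es)))"
    unfolding twist_multilinear[OF K degrees_shift[OF a]] pairing_commute[of n "weight b"]
    by (rule lin_scale[OF multilinear_slot[OF M]])
  also have "M (map (twist (weight (a + b))) As @ K (map ?\<theta> Bs) # (map ?\<theta> Cs @ L Ds # Es))
      = plug b L (l + arity a + p) (plug a K l M) (As @ Bs @ Cs @ Ds @ Es)"
    using len by (simp add: plug_def twist_comp shift_add add.commute)
  finally show ?thesis .
qed

definition associator ::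
  "(nat \<Rightarrow> int) \<Rightarrow> (nat \<Rightarrow> int) \<Rightarrow> (nat \<Rightarrow> int) \<Rightarrow>
    ('v list \<Rightarrow> 'v) \<Rightarrow> ('v list \<Rightarrow> 'v) \<Rightarrow> ('v list \<Rightarrow> 'v) \<Rightarrow> 'v list \<Rightarrow> 'v"
  where "associator a b c K L M = circ a (b + c) K (circ b c L M) - circ (a + b) c (circ a b K L) M"

text \<open>
  The summand of \<open>j(K)j(L)M\<close> with \<open>L\<close> in slot \<open>i\<close> of \<open>M\<close> and \<open>K\<close> in slot \<open>l\<close> of the result.
\<close>

definition double_insertion ::
  "(nat \<Rightarrow> int) \<Rightarrow> (nat \<Rightarrow> int) \<Rightarrow> (nat \<Rightarrow> int) \<Rightarrow>
    ('v list \<Rightarrow> 'v) \<Rightarrow> ('v list \<Rightarrow> 'v) \<Rightarrow> ('v list \<Rightarrow> 'v) \<Rightarrow> 'v list \<Rightarrow> nat \<Rightarrow> nat \<Rightarrow> 'v"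
  where "double_insertion a b c K L M Xs l i =
    scale (sign (a 0 * int l + pairing n (weight a) (weight (b + c)))
        * sign (b 0 * int i + pairing n (weight b) (weight c)))
      (plug a K l (plug b L i M) Xs)"

context
  fixes a b c :: "nat \<Rightarrow> int" and K L M :: "'v list \<Rightarrow> 'v" and Xs :: "'v list" and r :: nat
  assumes K: "K \<in> maps a" and L: "L \<in> maps b" and M: "M \<in> maps c"
    and a: "a \<in> degrees (Suc n)" and b: "b \<in> degrees (Suc n)" and c: "c \<in> degrees (Suc n)"
    and bounds: "a 0 \<ge> -1" "b 0 \<ge> -1" "c 0 = int r"
    and len: "int (length Xs) = a 0 + b 0 + c 0 + 1"
begin

lemma circ_circ_right:
  "circ a (b + c) K (circ b c L M) Xs
    = (\<Sum>i<Suc r. \<Sum>l<arity b + r. double_insertion a b c K L M Xs l i)"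
proof -
  have ar: "arity (b + c) = arity b + r" "arity c = Suc r" using bounds by auto
  have "plug a K l (circ b c L M) Xs
      = (\<Sum>i<Suc r. scale (sign (b 0 * int i + pairing n (weight b) (weight c)))
          (plug a K l (plug b L i M) Xs))" if "l < arity b + r" for l
    using that bounds len ar by (simp add: plug_def circ_def del: sum.lessThan_Suc)
  then have "circ a (b + c) K (circ b c L M) Xs
      = (\<Sum>l<arity b + r. \<Sum>i<Suc r. double_insertion a b c K L M Xs l i)"
    using len ar
    by (simp add: circ_def double_insertion_def scale_sum_right add.assoc del: sum.lessThan_Suc)
  then show ?thesis by (subst sum.swap) 
qed

text \<open>
  These are the summands of \<open>j(K)j(L)M\<close> in which \<open>K\<close> falls inside \<open>L\<close>.
\<close>

lemma circ_circ_left: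
  "circ (a + b) c (circ a b K L) M Xs
    = (\<Sum>i<Suc r. \<Sum>j<arity b. double_insertion a b c K L M Xs (i + j) i)"
proof -
  have ar: "arity c = Suc r" using bounds by simp
  have "scale (sign ((a + b) 0 * int i + pairing n (weight (a + b)) (weight c)))
        (plug (a + b) (circ a b K L) i M Xs)
      = (\<Sum>j<arity b. double_insertion a b c K L M Xs (i + j) i)" if i: "i < Suc r" for i
  proof (cases "arity b = 0")
    \<comment> \<open>An operation without slots admits no insertion; the arity of the composite would not be
      \<open>arity a + arity b - 1\<close> if both were 0.\<close>
    case True
    then have "circ a b K L = 0" by (simp add: circ_def fun_eq_iff)
    then show ?thesis using True plug_zero(1)[OF M] by simp
  next
    case False
    then obtain m where m: "arity b = Suc m" using not0_implies_Suc by blast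
    then have ab: "arity (a + b) = arity a + m" "a 0 + b 0 + 1 = int (arity a + m)"
      using bounds by auto
    have "int (length Xs) = int (arity a + m + r)" using len ab bounds by simp
    then have N: "length Xs = arity a + m + r" by linarith
    obtain As Rs where As: "Xs = As @ Rs" "length As = i"
      using split_list_at[of i Xs] i N by auto
    obtain Bs Es where Bs: "Rs = Bs @ Es" "length Bs = arity a + m"
      using split_list_at[of "arity a + m" Rs] i N As by auto
    let ?\<theta> = "twist (weight (a + b))"
    have eval: "plug a K (i + j) (plug b L i M) Xs = M (map ?\<theta> As @ plug a K j L Bs # Es)"
      if j: "j < Suc m" for j
    proof -
      obtain B1 S where B1: "Bs = B1 @ S" "length B1 = j"
        using split_list_at[of j Bs] j Bs by auto
      obtain B2 B3 where B2: "S = B2 @ B3" "length B2 = arity a"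
        using split_list_at[of "arity a" S] j B1 Bs by auto
      show ?thesis
        using plug_nested[where As = As and Bs = B1 and Cs = B2 and Ds = B3 and Es = Es] As Bs B1 B2 m by simp
    qed
    have "plug (a + b) (circ a b K L) i M Xs = M (map ?\<theta> As @ circ a b K L Bs # Es)"
      using As Bs ab by (simp add: plug_def)
    also have "circ a b K L Bs = (\<Sum>j<Suc m.
        scale (sign (a 0 * int j + pairing n (weight a) (weight b))) (plug a K j L Bs))"
      using Bs ab m by (simp add: circ_def del: sum.lessThan_Suc)
    also have "M (map ?\<theta> As @ \<dots> # Es) = (\<Sum>j<Suc m.
        scale (sign (a 0 * int j + pairing n (weight a) (weight b)))
          (M (map ?\<theta> As @ plug a K j L Bs # Es)))"
      by (simp add: lin_sum[OF multilinear_slot[OF M]] lin_scale[OF multilinear_slot[OF M]]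
          del: sum.lessThan_Suc)
    finally have expand: "plug (a + b) (circ a b K L) i M Xs = \<dots>" .
    show ?thesis
      unfolding expand m double_insertion_def scale_sum_right scale_scale sign_add[symmetric]
    proof (intro sum.cong refl arg_cong2[of _ _ _ _ scale] sign_cong)
      fix j assume "j \<in> {..<Suc m}"
      then show "M (map ?\<theta> As @ plug a K j L Bs # Es) = plug a K (i + j) (plug b L i M) Xs"
        using eval by simp
    qed (simp add: shift_add pairing_add_left pairing_add_right algebra_simps)
  qed
  then show ?thesis using len ar by (simp add: circ_def del: sum.lessThan_Suc)
qed

text \<open>
  After the summands with nested insertions have cancelled, those remain in which \<open>K\<close> and \<open>L\<close> occupy
  different slots of \<open>M\<close>, with \<open>K\<close> before \<open>L\<close> in the first sum and after it in the second.
\<close>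

lemma associator_expand:
  "associator a b c K L M Xs
    = (\<Sum>i<Suc r. \<Sum>l<i. double_insertion a b c K L M Xs l i)
      + (\<Sum>i<Suc r. \<Sum>t\<in>{i..<r}. double_insertion a b c K L M Xs (arity b + t) i)"
proof -
  have "(\<Sum>i<Suc r. \<Sum>l<arity b + r. double_insertion a b c K L M Xs l i)
      = (\<Sum>i<Suc r. (\<Sum>l<i. double_insertion a b c K L M Xs l i)
          + (\<Sum>j<arity b. double_insertion a b c K L M Xs (i + j) i)
          + (\<Sum>t\<in>{i..<r}. double_insertion a b c K L M Xs (arity b + t) i))"
    by (intro sum.cong refl sum_split_three) simp
  then show ?thesis
    by (simp add: associator_def circ_circ_right circ_circ_left sum.distrib algebra_simps
        del: sum.lessThan_Suc)
qed

text \<open>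
  The sign consists of the exchange sign of \<open>plug_disjoint\<close>, which accounts for the weights, and of the
  form degrees: exchanging the order of insertion shifts the slot of \<open>L\<close> by \<open>a 0\<close>, which multiplies
  the sign by \<open>(-1)\<close> to the power \<open>a 0 * b 0\<close>.
\<close>

lemma double_insertion_commute:
  assumes "i \<le> t" "t < r"
  shows "double_insertion a b c K L M Xs i (Suc t)
    = scale (sign (pairing (Suc n) a b)) (double_insertion b a c L K M Xs (arity a + t) i)"
proof -
  obtain p where p: "t = i + p" using assms le_Suc_ex by blast
  have "int (length Xs) = int (arity a + arity b + r) - 1" using len bounds by simp
  then have N: "Suc (length Xs) = arity a + arity b + r" by linarith
  obtain As R1 where As: "Xs = As @ R1" "length As = i"
    using split_list_at[of i Xs] p assms N by auto
  obtain Bs R2 where Bs: "R1 = Bs @ R2" "length Bs = arity a"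
    using split_list_at[of "arity a" R1] p assms N As by auto
  obtain Cs R3 where Cs: "R2 = Cs @ R3" "length Cs = p"
    using split_list_at[of p R2] p assms N As Bs by auto
  obtain Ds Es where Ds: "R3 = Ds @ Es" "length Ds = arity b"
    using split_list_at[of "arity b" R3] p assms N As Bs Cs by auto
  have "plug a K i (plug b L (Suc t) M) Xs
      = scale (sign (pairing n (weight a) (weight b))) (plug b L (arity a + t) (plug a K i M) Xs)"
    using plug_disjoint[where a = a and b = b and c = c and L = L and Es = Es, OF K M a As(2) Bs(2) Cs(2) Ds(2)] As Bs Cs Ds p
    by (simp add: add_ac)
  moreover have "int (arity a) = a 0 + 1" using bounds by simp
  ultimately show ?thesis
    unfolding double_insertion_def
    by (auto intro!: arg_cong2[of _ _ _ _ scale] sign_cong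
        simp: sign_add[symmetric] shift_add pairing_Suc pairing_add_right
          pairing_commute[of n "weight b" "weight a"] algebra_simps)
qed

end

text \<open>
  Exchanging \<open>K\<close> and \<open>L\<close> exchanges the two sums of the expanded associator. So insertion is a graded
  pre-Lie product.
\<close>

lemma associator_symmetric:
  assumes K: "K \<in> maps a" and L: "L \<in> maps b" and M: "M \<in> maps c"
    and a: "a \<in> degrees (Suc n)" and b: "b \<in> degrees (Suc n)" and c: "c \<in> degrees (Suc n)"
  shows "associator a b c K L M Xs
    = scale (sign (pairing (Suc n) a b)) (associator b a c L K M Xs)"
proof (cases "int (length Xs) = a 0 + b 0 + c 0 + 1 \<and> a 0 \<ge> -1 \<and> b 0 \<ge> -1 \<and> c 0 \<ge> 0")
  case True
  then obtain r where r: "c 0 = int r" using nonneg_int_cases by metis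
  have len: "int (length Xs) = a 0 + b 0 + c 0 + 1" "int (length Xs) = b 0 + a 0 + c 0 + 1"
    and low: "a 0 \<ge> -1" "b 0 \<ge> -1" using True by auto
  let ?W = "double_insertion a b c K L M Xs" and ?W' = "double_insertion b a c L K M Xs"
  let ?\<epsilon> = "sign (pairing (Suc n) a b) :: 'k"
  note comm = double_insertion_commute[OF K L M a b c low r len(1)]
    double_insertion_commute[OF L K M b a c low(2,1) r len(2)]
  have "(\<Sum>i<Suc r. \<Sum>l<i. ?W l i) = (\<Sum>i<Suc r. \<Sum>t\<in>{i..<r}. scale ?\<epsilon> (?W' (arity a + t) i))"
    unfolding sum_triangle by (intro sum.cong refl comm(1)) auto
  moreover have "(\<Sum>i<Suc r. \<Sum>t\<in>{i..<r}. ?W (arity b + t) i) = (\<Sum>i<Suc r. \<Sum>l<i. scale ?\<epsilon> (?W' l i))"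
    unfolding sum_triangle
  proof (intro sum.cong refl)
    fix i t assume "i \<in> {..<Suc r}" "t \<in> {i..<r}"
    then show "?W (arity b + t) i = scale ?\<epsilon> (?W' i (Suc t))"
      using comm(2)[of i t] by (simp add: pairing_commute[of "Suc n" b a] sign_square)
  qed
  ultimately show ?thesis
    unfolding associator_expand[OF K L M a b c low r len(1)]
      associator_expand[OF L K M b a c low(2,1) r len(2)]
    by (simp only: scale_right_distrib scale_sum_right add.commute)
next
  case False
  \<comment> \<open>Both sides vanish: the arguments have the wrong number, \<open>K\<close> or \<open>L\<close> is zero for reasons of degree,
    or \<open>M\<close> has no slots.\<close>
  have zero: "associator a b c K L M Xs = 0"
    if K: "K \<in> maps a" and L: "L \<in> maps b"
      and a: "a \<in> degrees (Suc n)" and b: "b \<in> degrees (Suc n)"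
      and no: "\<not> (int (length Xs) = a 0 + b 0 + c 0 + 1 \<and> a 0 \<ge> -1 \<and> b 0 \<ge> -1 \<and> c 0 \<ge> 0)" for a b K L
  proof -
    consider "int (length Xs) \<noteq> a 0 + b 0 + c 0 + 1" | "K = 0" | "L = 0" | "arity c = 0"
      using no multilinear_low[OF K] multilinear_low[OF L] by fastforce
    then show ?thesis
    proof cases
      case 4
      then have "circ d c N M = 0" for d N by (simp add: fun_eq_iff circ_def)
      then show ?thesis by (simp add: associator_def circ_zero)
    qed (simp_all add: associator_def circ_wrong_length circ_zero(2)
        circ_zero(1)[OF circ_in_maps[OF L M b c]]
        circ_zero(1)[OF L] circ_zero(1)[OF M])
  qed
  from False show ?thesis
    using zero[OF K L a b] zero[OF L K b a] by (simp add: add.commute)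
qed

section \<open>The bracket of homogeneous elements\<close>

definition bracket ::
  "(nat \<Rightarrow> int) \<Rightarrow> (nat \<Rightarrow> int) \<Rightarrow> ('v list \<Rightarrow> 'v) \<Rightarrow> ('v list \<Rightarrow> 'v) \<Rightarrow> 'v list \<Rightarrow> 'v"
  where "bracket a b K L =
    circ a b K L + (\<lambda>Xs. scale (- sign (pairing (Suc n) a b)) (circ b a L K Xs))"

lemma homogeneous_bracket_eq:
  assumes "K \<in> maps a" "L \<in> maps b" "a \<in> degrees (Suc n)" "b \<in> degrees (Suc n)"
  shows "homogeneous_bracket scale n Vg (a 0) (weight a) (b 0) (weight b) K L = bracket a b K L"
  unfolding homogeneous_bracket_def bracket_def
    insertion_eq_circ[OF assms] insertion_eq_circ[OF assms(2,1,4,3)] pairing_Suc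
  by (simp add: fun_eq_iff)

lemma maps_zero: "a \<in> degrees (Suc n) \<Longrightarrow> 0 \<in> maps a"
  unfolding multilinear_maps_iff slotwise_linear_def
  by (auto intro!: linI subspace_0 subspace_Vg degrees_add degrees_sum_list degrees_shift
      dest: homogeneous_args_degrees simp del: o_apply)

lemma maps_add:
  assumes K: "K \<in> maps a" and L: "L \<in> maps a" and a: "a \<in> degrees (Suc n)"
  shows "K + L \<in> maps a"
  unfolding multilinear_maps_iff
proof (intro conjI allI impI)
  show "slotwise_linear (arity a) (K + L)"
    unfolding slotwise_linear_def
    using lin_add[OF multilinear_slot[OF K]] lin_add[OF multilinear_slot[OF L]]
      lin_scale[OF multilinear_slot[OF K]] lin_scale[OF multilinear_slot[OF L]]
    by (auto intro!: linI simp: scale_right_distrib)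
  show "(K + L) Xs \<in> Vg (sum_list xs + weight a)"
    if "int (length Xs) = a 0 + 1 \<and> homogeneous_args n Vg Xs xs" for Xs xs
    unfolding plus_fun_apply[of K L]
    using that a multilinear_degree[OF K, of Xs xs] multilinear_degree[OF L, of Xs xs]
    by (intro subspace_add subspace_Vg degrees_add degrees_sum_list degrees_shift
        homogeneous_args_degrees) auto
qed (use multilinear_wrong_length[OF K] multilinear_wrong_length[OF L] in auto)

lemma maps_scale:
  assumes K: "K \<in> maps a" and a: "a \<in> degrees (Suc n)"
  shows "(\<lambda>Xs. scale r (K Xs)) \<in> maps a"
  unfolding multilinear_maps_iff
proof (intro conjI allI impI)
  show "slotwise_linear (arity a) (\<lambda>Xs. scale r (K Xs))"
    unfolding slotwise_linear_def using lin_scale_fun[OF multilinear_slot[OF K]] by blast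
  show "scale r (K Xs) \<in> Vg (sum_list xs + weight a)"
    if "int (length Xs) = a 0 + 1 \<and> homogeneous_args n Vg Xs xs" for Xs xs
    using that a multilinear_degree[OF K, of Xs xs]
    by (intro subspace_scale subspace_Vg degrees_add degrees_sum_list degrees_shift
        homogeneous_args_degrees) auto
qed (use multilinear_wrong_length[OF K] in auto)

lemma maps_sum:
  assumes "\<And>i. i \<in> I \<Longrightarrow> K i \<in> maps a" and "a \<in> degrees (Suc n)"
  shows "sum K I \<in> maps a"
  using assms(1)
  by (induction I rule: infinite_finite_induct) (auto simp: maps_zero maps_add assms(2))

lemma bracket_in_maps:
  assumes "K \<in> maps a" "L \<in> maps b" "a \<in> degrees (Suc n)" "b \<in> degrees (Suc n)"
  shows "bracket a b K L \<in> maps (a + b)"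
  unfolding bracket_def
  using circ_in_maps[OF assms] circ_in_maps[OF assms(2,1,4,3)] assms(3,4)
  by (intro maps_add maps_scale degrees_add) (simp_all only: add.commute)

lemma bracket_zero:
  "L \<in> maps b \<Longrightarrow> bracket a b 0 L = 0" "K \<in> maps a \<Longrightarrow> bracket a b K 0 = 0"
  by (simp_all add: bracket_def circ_zero fun_eq_iff)

lemma bracket_add_left: "L \<in> maps b \<Longrightarrow> bracket a b (K + K') L = bracket a b K L + bracket a b K' L"
  and bracket_add_right: "K \<in> maps a \<Longrightarrow> bracket a b K (L + L') = bracket a b K L + bracket a b K L'"
  by (simp_all add: bracket_def circ_add_left circ_add_right fun_eq_iff scale_right_diff_distrib scale_right_distrib)

lemma bracket_scale_left:
    "L \<in> maps b \<Longrightarrow> bracket a b (\<lambda>Xs. scale r (K Xs)) L = (\<lambda>Xs. scale r (bracket a b K L Xs))"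
  and bracket_scale_right:
    "K \<in> maps a \<Longrightarrow> bracket a b K (\<lambda>Xs. scale r (L Xs)) = (\<lambda>Xs. scale r (bracket a b K L Xs))"
  by (simp_all add: bracket_def circ_scale_left circ_scale_right fun_eq_iff
      scale_right_diff_distrib mult.commute)

lemma bracket_antisym:
  "bracket a b K L Xs = - scale (sign (pairing (Suc n) a b)) (bracket b a L K Xs)"
  by (simp add: bracket_def pairing_commute[of "Suc n" b a] scale_right_diff_distrib sign_square)

lemma bracket_apply:
  "bracket a b K L Xs = circ a b K L Xs - scale (sign (pairing (Suc n) a b)) (circ b a L K Xs)"
  by (simp add: bracket_def)

lemma circ_bracket_right:
  "circ d e N (bracket a b K L) Xs = circ d e N (circ a b K L) Xs
    - scale (sign (pairing (Suc n) a b)) (circ d e N (circ b a L K) Xs)"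
  unfolding bracket_def circ_add_right circ_scale_right by simp

lemma circ_bracket_left:
  assumes "N \<in> maps e"
  shows "circ d e (bracket a b K L) N Xs = circ d e (circ a b K L) N Xs
    - scale (sign (pairing (Suc n) a b)) (circ d e (circ b a L K) N Xs)"
  unfolding bracket_def circ_add_left[OF assms] circ_scale_left[OF assms] by simp

text \<open>
  The graded commutator of a graded pre-Lie product satisfies the Jacobi identity: its twelve terms
  group into the associators with last entry \<open>M\<close>, \<open>L\<close> and \<open>K\<close>, each occurring antisymmetrised in the first
  two entries.
\<close>

lemma bracket_jacobi:
  assumes K: "K \<in> maps a" and L: "L \<in> maps b" and M: "M \<in> maps c"
    and a: "a \<in> degrees (Suc n)" and b: "b \<in> degrees (Suc n)" and c: "c \<in> degrees (Suc n)"
  shows "bracket a (b + c) K (bracket b c L M) Xs = bracket (a + b) c (bracket a b K L) M Xs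
    + scale (sign (pairing (Suc n) a b)) (bracket b (a + c) L (bracket a c K M) Xs)"
proof -
  let ?p = "pairing (Suc n)"
  define u v w :: 'k where "u = sign (?p a b)" and "v = sign (?p a c)" and "w = sign (?p b c)"
  have sgn: "u = 1 \<or> u = -1" "v = 1 \<or> v = -1" "w = 1 \<or> w = -1"
    unfolding u_def v_def w_def sign_parity by auto
  have signs: "sign (?p a b) = u" "sign (?p a c) = v" "sign (?p b c) = w"
    "sign (?p a (b + c)) = u * v" "sign (?p (a + b) c) = v * w" "sign (?p b (a + c)) = u * w"
    by (simp_all add: u_def v_def w_def pairing_add_left pairing_add_right sign_add
        pairing_commute[of "Suc n" b a])
  note comm = add.commute[of c b] add.commute[of c a] add.commute[of b a]
  \<comment> \<open>The symmetry of the three associators, solved for one term of each.\<close>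
  have exchange:
    "circ a (b + c) K (circ b c L M) Xs = circ (a + b) c (circ a b K L) M Xs
      + scale u (circ b (a + c) L (circ a c K M) Xs - circ (a + b) c (circ b a L K) M Xs)"
    "circ a (b + c) K (circ c b M L) Xs = circ (a + c) b (circ a c K M) L Xs
      + scale v (circ c (a + b) M (circ a b K L) Xs - circ (a + c) b (circ c a M K) L Xs)"
    "circ b (a + c) L (circ c a M K) Xs = circ (b + c) a (circ b c L M) K Xs
      + scale w (circ c (a + b) M (circ b a L K) Xs - circ (b + c) a (circ c b M L) K Xs)"
    using associator_symmetric[OF K L M a b c, of Xs] associator_symmetric[OF K M L a c b, of Xs]
      associator_symmetric[OF L M K b c a, of Xs]
    unfolding associator_def minus_apply signs comm by (simp_all add: diff_eq_eq add.commute)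
  show ?thesis
    unfolding bracket_apply circ_bracket_right circ_bracket_left[OF K] circ_bracket_left[OF L]
      circ_bracket_left[OF M] signs comm exchange
    using sgn by (elim disjE) (simp_all add: algebra_simps)
qed

section \<open>The graded Lie algebra of multilinear maps\<close>

abbreviation M :: "((nat \<Rightarrow> int) \<Rightarrow> 'v list \<Rightarrow> 'v) set"
  where "M \<equiv> M_space scale n Vg"

abbreviation Mg :: "(nat \<Rightarrow> int) \<Rightarrow> ((nat \<Rightarrow> int) \<Rightarrow> 'v list \<Rightarrow> 'v) set"
  where "Mg \<equiv> M_component scale n Vg"

abbreviation support :: "((nat \<Rightarrow> int) \<Rightarrow> 'v list \<Rightarrow> 'v) \<Rightarrow> (nat \<Rightarrow> int) set"
  where "support F \<equiv> {a. F a \<noteq> 0}"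

lemma M_I:
  assumes "finite A" "A \<subseteq> degrees (Suc n)" "support F \<subseteq> A" "\<And>a. a \<in> degrees (Suc n) \<Longrightarrow> F a \<in> maps a"
  shows "F \<in> M"
  using assms finite_subset unfolding M_space_def by blast

lemma M_finite: "F \<in> M \<Longrightarrow> finite (support F)"
  and M_support: "F \<in> M \<Longrightarrow> support F \<subseteq> degrees (Suc n)"
  and M_maps: "F \<in> M \<Longrightarrow> a \<in> degrees (Suc n) \<Longrightarrow> F a \<in> maps a"
  unfolding M_space_def by auto

lemma vector_space_M_scale: "vector_space (M_scale scale)"
  by unfold_locales
    (simp_all add: M_scale_def fun_eq_iff scale_right_distrib scale_left_distrib)

lemma M_zero: "0 \<in> M"
  by (rule M_I[of "{}"]) (auto simp: maps_zero)

lemma M_add: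
  assumes F: "F \<in> M" and G: "G \<in> M"
  shows "F + G \<in> M"
  by (rule M_I[of "support F \<union> support G"])
    (use M_finite[OF F] M_finite[OF G] M_support[OF F] M_support[OF G] M_maps[OF F] M_maps[OF G]
      in \<open>auto intro: maps_add\<close>)

lemma M_scale_support: "support (M_scale scale r F) \<subseteq> support F"
  by (auto simp: M_scale_def fun_eq_iff)

lemma M_scale_closed:
  assumes F: "F \<in> M"
  shows "M_scale scale r F \<in> M"
proof (rule M_I[OF M_finite[OF F] M_support[OF F] M_scale_support])
  show "M_scale scale r F a \<in> maps a" if "a \<in> degrees (Suc n)" for a
    using M_maps[OF F that] that unfolding M_scale_def by (intro maps_scale)
qed

lemma subspace_M: "module.subspace (M_scale scale) M"
proof -
  interpret MV: vector_space "M_scale scale" by (rule vector_space_M_scale)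
  show ?thesis by (rule MV.subspaceI) (simp_all add: M_zero M_add M_scale_closed)
qed

lemma subspace_Mg: "module.subspace (M_scale scale) (Mg a)"
proof -
  interpret MV: vector_space "M_scale scale" by (rule vector_space_M_scale)
  show ?thesis
    by (rule MV.subspaceI)
      (simp_all add: M_component_def M_zero M_add M_scale_closed, simp add: M_scale_def fun_eq_iff)
qed

lemma M_direct_sum:
  assumes F: "F \<in> M"
  shows "\<exists>!c. homogeneous_decomposition (Suc n) Mg c F"
proof (rule ex1I)
  let ?c = "\<lambda>a b. if b = a then F a else 0"
  have supp: "{a. ?c a \<noteq> 0} = support F" by (auto simp: fun_eq_iff)
  have "?c a \<in> Mg a" if "a \<in> degrees (Suc n)" for a
  proof -
    have "?c a \<in> M"
      by (rule M_I[of "{a}"]) (use that M_maps[OF F] in \<open>auto simp: maps_zero\<close>)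
    then show ?thesis by (simp add: M_component_def)
  qed
  moreover have "F = (\<Sum>a\<in>support F. ?c a)"
  proof
    show "F b = (\<Sum>a\<in>support F. ?c a) b" for b
      unfolding sum_fun_apply[where x = b] using M_finite[OF F] by (auto simp: sum.delta)
  qed
  ultimately show "homogeneous_decomposition (Suc n) Mg ?c F"
    unfolding homogeneous_decomposition_def supp using M_finite[OF F] M_support[OF F] by blast
next
  fix c assume "homogeneous_decomposition (Suc n) Mg c F"
  then have fin: "finite {a. c a \<noteq> 0}" and sub: "{a. c a \<noteq> 0} \<subseteq> degrees (Suc n)"
    and comp: "\<And>a. a \<in> degrees (Suc n) \<Longrightarrow> c a \<in> Mg a" and F_eq: "F = (\<Sum>a | c a \<noteq> 0. c a)"
    unfolding homogeneous_decomposition_def by auto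
  have off: "c a b = 0" if "b \<noteq> a" for a b
    using comp[of a] sub that by (cases "c a = 0") (auto simp: M_component_def)
  have "F b = c b b" for b
  proof -
    have "F b = (\<Sum>a | c a \<noteq> 0. c a b)" by (subst F_eq) (rule sum_fun_apply)
    also have "\<dots> = (\<Sum>a | c a \<noteq> 0. if a = b then c b b else 0)"
      by (intro sum.cong) (auto simp: off)
    also have "\<dots> = c b b" using fin by (auto simp: sum.delta)
    finally show ?thesis .
  qed
  then have "c a b = (if b = a then F a else 0)" for a b by (simp add: off)
  then show "c = (\<lambda>a b. if b = a then F a else 0)" by (intro ext) (simp only:)
qed

lemma graded_vector_space_M: "graded_vector_space (M_scale scale) (Suc n) M Mg"
  by (intro graded_vector_space.intro graded_vector_space_axioms.intro vector_space_M_scale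
      subspace_M subspace_Mg M_direct_sum) (auto simp: M_component_def)

text \<open>
  Summing over a fixed rectangle instead of the supports makes the bracket visibly bilinear, since the
  same rectangle can be used for several families.
\<close>

lemma M_bracket_sum:
  assumes F: "F \<in> M" and G: "G \<in> M"
    and A: "finite A" "support F \<subseteq> A" "A \<subseteq> degrees (Suc n)"
    and B: "finite B" "support G \<subseteq> B" "B \<subseteq> degrees (Suc n)"
  shows "M_bracket scale n Vg F G d
    = (\<Sum>(a, b) | (a, b) \<in> A \<times> B \<and> a + b = d. bracket a b (F a) (G b))"
proof -
  let ?S = "{(a, b). F a \<noteq> 0 \<and> G b \<noteq> 0 \<and> a + b = d}"
  let ?T = "{(a, b). (a, b) \<in> A \<times> B \<and> a + b = d}"
  have "M_bracket scale n Vg F G d = (\<Sum>(a, b)\<in>?S. bracket a b (F a) (G b))"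
    unfolding M_bracket_def
  proof (intro sum.cong refl, clarify)
    fix a b assume "F a \<noteq> 0" "G b \<noteq> 0"
    then have "a \<in> degrees (Suc n)" "b \<in> degrees (Suc n)" using A B by auto
    then show "homogeneous_bracket scale n Vg (a 0) (weight a) (b 0) (weight b) (F a) (G b)
        = bracket a b (F a) (G b)"
      by (intro homogeneous_bracket_eq M_maps[OF F] M_maps[OF G])
  qed
  also have "\<dots> = (\<Sum>(a, b)\<in>?T. bracket a b (F a) (G b))"
  proof (rule sum.mono_neutral_left)
    show "finite ?T" by (rule finite_subset[of _ "A \<times> B"]) (use A B in auto)
    show "\<forall>p\<in>?T - ?S. (case p of (a, b) \<Rightarrow> bracket a b (F a) (G b)) = 0"
    proof
      fix p assume p: "p \<in> ?T - ?S"
      obtain a b where ab: "p = (a, b)" by (cases p)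
      have "F a \<in> maps a" "G b \<in> maps b"
        using p ab A(3) B(3) by (auto intro: M_maps[OF F] M_maps[OF G])
      then show "(case p of (a, b) \<Rightarrow> bracket a b (F a) (G b)) = 0"
        using p ab bracket_zero by auto
    qed
  qed (use A B in auto)
  finally show ?thesis .
qed

lemma M_bracket_closed:
  assumes F: "F \<in> M" and G: "G \<in> M"
  shows "M_bracket scale n Vg F G \<in> M"
proof (rule M_I[of "(\<lambda>(a, b). a + b) ` (support F \<times> support G)"])
  note sum = M_bracket_sum[OF F G M_finite[OF F] order_refl M_support[OF F]
      M_finite[OF G] order_refl M_support[OF G]]
  show "support (M_bracket scale n Vg F G) \<subseteq> (\<lambda>(a, b). a + b) ` (support F \<times> support G)"
  proof (rule subsetI, rule ccontr)
    fix d assume d: "d \<in> support (M_bracket scale n Vg F G)"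
      and no: "d \<notin> (\<lambda>(a, b). a + b) ` (support F \<times> support G)"
    from no have empty: "{(a, b). (a, b) \<in> support F \<times> support G \<and> a + b = d} = {}" by force
    have "M_bracket scale n Vg F G d = 0" unfolding sum empty by (rule sum.empty)
    with d show False by simp
  qed
  show "M_bracket scale n Vg F G d \<in> maps d" if d: "d \<in> degrees (Suc n)" for d
    unfolding sum
  proof (rule maps_sum[OF _ d], clarify)
    fix a b assume "d = a + b" "F a \<noteq> 0" "G b \<noteq> 0"
    then have "a \<in> degrees (Suc n)" "b \<in> degrees (Suc n)"
      using M_support[OF F] M_support[OF G] by auto
    then show "bracket a b (F a) (G b) \<in> maps (a + b)"
      by (intro bracket_in_maps M_maps[OF F] M_maps[OF G])
  qed
qed (use M_finite[OF F] M_finite[OF G] M_support[OF F] M_support[OF G] in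
    \<open>auto intro!: degrees_add\<close>)

lemma M_bracket_add_left:
  assumes F: "F \<in> M" and F': "F' \<in> M" and G: "G \<in> M"
  shows "M_bracket scale n Vg (F + F') G = M_bracket scale n Vg F G + M_bracket scale n Vg F' G"
proof
  fix d
  let ?A = "support F \<union> support F'" and ?B = "support G"
  have A: "finite ?A" "?A \<subseteq> degrees (Suc n)" and B: "finite ?B" "?B \<subseteq> degrees (Suc n)"
    using assms M_finite M_support by auto
  have *: "M_bracket scale n Vg H G d
      = (\<Sum>(a, b) | (a, b) \<in> ?A \<times> ?B \<and> a + b = d. bracket a b (H a) (G b))"
    if "H \<in> M" "support H \<subseteq> ?A" for H
    by (rule M_bracket_sum[OF that(1) G A(1) that(2) A(2) B(1) order_refl B(2)])
  have "bracket a b ((F + F') a) (G b) = bracket a b (F a) (G b) + bracket a b (F' a) (G b)"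
    if "b \<in> ?B" for a b
    unfolding plus_fun_apply[of F F'] using that B M_maps[OF G] by (intro bracket_add_left) auto
  then have "(\<Sum>(a, b) | (a, b) \<in> ?A \<times> ?B \<and> a + b = d. bracket a b ((F + F') a) (G b))
      = (\<Sum>(a, b) | (a, b) \<in> ?A \<times> ?B \<and> a + b = d. bracket a b (F a) (G b))
        + (\<Sum>(a, b) | (a, b) \<in> ?A \<times> ?B \<and> a + b = d. bracket a b (F' a) (G b))"
    unfolding sum.distrib[symmetric] by (intro sum.cong) auto
  moreover have "support (F + F') \<subseteq> ?A" by auto
  ultimately show "M_bracket scale n Vg (F + F') G d
      = (M_bracket scale n Vg F G + M_bracket scale n Vg F' G) d"
    using *[OF M_add[OF F F']] *[OF F Un_upper1] *[OF F' Un_upper2] by simp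
qed

lemma M_bracket_add_right:
  assumes F: "F \<in> M" and G: "G \<in> M" and G': "G' \<in> M"
  shows "M_bracket scale n Vg F (G + G') = M_bracket scale n Vg F G + M_bracket scale n Vg F G'"
proof
  fix d
  let ?A = "support F" and ?B = "support G \<union> support G'"
  have A: "finite ?A" "?A \<subseteq> degrees (Suc n)" and B: "finite ?B" "?B \<subseteq> degrees (Suc n)"
    using assms M_finite M_support by auto
  have *: "M_bracket scale n Vg F H d
      = (\<Sum>(a, b) | (a, b) \<in> ?A \<times> ?B \<and> a + b = d. bracket a b (F a) (H b))"
    if "H \<in> M" "support H \<subseteq> ?B" for H
    by (rule M_bracket_sum[OF F that(1) A(1) order_refl A(2) B(1) that(2) B(2)])
  have "bracket a b (F a) ((G + G') b) = bracket a b (F a) (G b) + bracket a b (F a) (G' b)"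
    if "a \<in> ?A" for a b
    unfolding plus_fun_apply[of G G'] using that A M_maps[OF F] by (intro bracket_add_right) auto
  then have "(\<Sum>(a, b) | (a, b) \<in> ?A \<times> ?B \<and> a + b = d. bracket a b (F a) ((G + G') b))
      = (\<Sum>(a, b) | (a, b) \<in> ?A \<times> ?B \<and> a + b = d. bracket a b (F a) (G b))
        + (\<Sum>(a, b) | (a, b) \<in> ?A \<times> ?B \<and> a + b = d. bracket a b (F a) (G' b))"
    unfolding sum.distrib[symmetric] by (intro sum.cong) auto
  moreover have "support (G + G') \<subseteq> ?B" by auto
  ultimately show "M_bracket scale n Vg F (G + G') d
      = (M_bracket scale n Vg F G + M_bracket scale n Vg F G') d"
    using *[OF M_add[OF G G']] *[OF G Un_upper1] *[OF G' Un_upper2] by simp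
qed

lemma M_bracket_scale:
  assumes F: "F \<in> M" and G: "G \<in> M"
  shows "M_bracket scale n Vg (M_scale scale r F) G = M_scale scale r (M_bracket scale n Vg F G)"
    and "M_bracket scale n Vg F (M_scale scale r G) = M_scale scale r (M_bracket scale n Vg F G)"
proof -
  let ?A = "support F" and ?B = "support G"
  note A = M_finite[OF F] M_support[OF F] and B = M_finite[OF G] M_support[OF G]
  have left: "bracket a b (M_scale scale r F a) (G b) = (\<lambda>Xs. scale r (bracket a b (F a) (G b) Xs))"
    and right: "bracket a b (F a) (M_scale scale r G b) = (\<lambda>Xs. scale r (bracket a b (F a) (G b) Xs))"
    if "a \<in> ?A" "b \<in> ?B" for a b
    using that A(2) B(2) M_maps[OF F] M_maps[OF G] unfolding M_scale_def
    by (auto intro!: bracket_scale_left bracket_scale_right)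
  have *: "M_bracket scale n Vg F' G' = M_scale scale r (M_bracket scale n Vg F G)"
    if "F' \<in> M" "G' \<in> M" "support F' \<subseteq> ?A" "support G' \<subseteq> ?B"
      and eq: "\<And>a b. a \<in> ?A \<Longrightarrow> b \<in> ?B \<Longrightarrow>
        bracket a b (F' a) (G' b) = (\<lambda>Xs. scale r (bracket a b (F a) (G b) Xs))" for F' G'
  proof (intro ext)
    fix d Xs
    show "M_bracket scale n Vg F' G' d Xs = M_scale scale r (M_bracket scale n Vg F G) d Xs"
      unfolding M_bracket_sum[OF that(1,2) A(1) that(3) A(2) B(1) that(4) B(2)]
        M_scale_def M_bracket_sum[OF F G A(1) order_refl A(2) B(1) order_refl B(2)]
        sum_fun_apply[where x = Xs] scale_sum_right
      by (intro sum.cong refl) (auto simp: eq)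
  qed
  show "M_bracket scale n Vg (M_scale scale r F) G = M_scale scale r (M_bracket scale n Vg F G)"
    by (rule *[OF M_scale_closed[OF F] G M_scale_support order_refl left])
  show "M_bracket scale n Vg F (M_scale scale r G) = M_scale scale r (M_bracket scale n Vg F G)"
    by (rule *[OF F M_scale_closed[OF G] order_refl M_scale_support right])
qed

lemma Mg_D:
  assumes "F \<in> Mg a" "a \<in> degrees (Suc n)"
  shows "F \<in> M" "F a \<in> maps a" "\<And>b. b \<noteq> a \<Longrightarrow> F b = 0"
  using assms by (auto simp: M_component_def M_maps)

lemma M_bracket_homogeneous:
  assumes a: "a \<in> degrees (Suc n)" and b: "b \<in> degrees (Suc n)" and F: "F \<in> Mg a" and G: "G \<in> Mg b"
  shows "M_bracket scale n Vg F G d = (if d = a + b then bracket a b (F a) (G b) else 0)"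
proof -
  have "M_bracket scale n Vg F G d
      = (\<Sum>(a', b') | (a', b') \<in> {a} \<times> {b} \<and> a' + b' = d. bracket a' b' (F a') (G b'))"
    by (rule M_bracket_sum) (use a b Mg_D[OF F a] Mg_D[OF G b] in auto)
  moreover have "{(a', b'). (a', b') \<in> {a} \<times> {b} \<and> a' + b' = d} = (if d = a + b then {(a, b)} else {})"
    by auto
  ultimately show ?thesis by (simp only: if_distrib[of "\<lambda>S. sum _ S"] sum.empty) simp
qed

lemma M_bracket_degree:
  assumes "a \<in> degrees (Suc n)" "b \<in> degrees (Suc n)" "F \<in> Mg a" "G \<in> Mg b"
  shows "M_bracket scale n Vg F G \<in> Mg (a + b)"
  using M_bracket_closed[OF Mg_D(1)[OF assms(3,1)] Mg_D(1)[OF assms(4,2)]] M_bracket_homogeneous[OF assms]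
  by (simp add: M_component_def)

theorem graded_lie_algebra_M:
  "graded_lie_algebra (M_scale scale) (Suc n) M Mg (M_bracket scale n Vg)"
proof (intro graded_lie_algebra.intro graded_vector_space_M graded_lie_algebra_axioms.intro)
  fix a b F G
  assume ab: "a \<in> degrees (Suc n)" "b \<in> degrees (Suc n)" and F: "F \<in> Mg a" and G: "G \<in> Mg b"
  show "M_bracket scale n Vg F G
      = - M_scale scale (sign (pairing (Suc n) a b)) (M_bracket scale n Vg G F)"
  proof (intro ext)
    fix d Xs
    show "M_bracket scale n Vg F G d Xs
        = (- M_scale scale (sign (pairing (Suc n) a b)) (M_bracket scale n Vg G F)) d Xs"
      using bracket_antisym[of a b "F a" "G b" Xs]
      by (simp add: M_scale_def M_bracket_homogeneous[OF ab F G]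
          M_bracket_homogeneous[OF ab(2,1) G F] add.commute[of b a])
  qed
  fix c H
  assume c: "c \<in> degrees (Suc n)" and H: "H \<in> Mg c"
  note FG = M_bracket_degree[OF ab F G] and GH = M_bracket_degree[OF ab(2) c G H]
    and FH = M_bracket_degree[OF ab(1) c F H]
  note add = degrees_add[OF ab] degrees_add[OF ab(2) c] degrees_add[OF ab(1) c]
  show "M_bracket scale n Vg F (M_bracket scale n Vg G H)
      = M_bracket scale n Vg (M_bracket scale n Vg F G) H
        + M_scale scale (sign (pairing (Suc n) a b)) (M_bracket scale n Vg G (M_bracket scale n Vg F H))"
  proof (intro ext)
    fix d Xs
    have "a + (b + c) = a + b + c" "b + (a + c) = a + b + c" by (simp_all only: add_ac)
    then show "M_bracket scale n Vg F (M_bracket scale n Vg G H) d Xs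
      = (M_bracket scale n Vg (M_bracket scale n Vg F G) H
        + M_scale scale (sign (pairing (Suc n) a b)) (M_bracket scale n Vg G (M_bracket scale n Vg F H))) d Xs"
      using bracket_jacobi[OF Mg_D(2)[OF F ab(1)] Mg_D(2)[OF G ab(2)] Mg_D(2)[OF H c] ab c, of Xs]
      by (simp add: M_scale_def M_bracket_homogeneous[OF ab(1) add(2) F GH]
          M_bracket_homogeneous[OF add(1) c FG H] M_bracket_homogeneous[OF ab(2) add(3) G FH]
          M_bracket_homogeneous[OF ab F G] M_bracket_homogeneous[OF ab(2) c G H]
          M_bracket_homogeneous[OF ab(1) c F H])
  qed
qed (rule M_bracket_closed M_bracket_add_left M_bracket_add_right M_bracket_scale M_bracket_degree;
    assumption)+

section \<open>Associative multiplications\<close>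

text \<open>
  In weight zero the twists are the identity, and the form degree 1 of \<open>\<mu>\<close> gives the minus sign: inserting
  \<open>\<mu>\<close> into itself yields the usual associator.
\<close>

lemma circ_self_multiplication:
  assumes "d 0 = 1" "weight d = 0"
  shows "circ d d \<mu> \<mu> [X, Y, Z] = \<mu> [\<mu> [X, Y], Z] - \<mu> [X, \<mu> [Y, Z]]"
proof -
  have "arity d = Suc (Suc 0)" using assms by simp
  then show ?thesis
    unfolding circ_def plug_def assms(2) by (simp add: assms(1) twist_zero_weight numeral_2_eq_2)
qed

text \<open>
  The sign in the bracket of \<open>\<mu>\<close> with itself is \<open>-1\<close>, so this bracket is twice the associator of \<open>\<mu>\<close>, and 2 is
  invertible in characteristic zero.
\<close>

lemma associative_iff:
  assumes \<mu>: "\<mu> \<in> multilinear_maps scale n Vg 1 0"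
  shows "associative_graded_multiplication scale n Vg (\<lambda>X Y. \<mu> [X, Y])
    \<longleftrightarrow> M_bracket scale n Vg (M_single 1 0 \<mu>) (M_single 1 0 \<mu>) = 0"
proof -
  define d :: "nat \<Rightarrow> int" where "d = case_nat 1 0"
  have d0: "d 0 = 1" and wd: "weight d = 0" by (simp_all add: d_def fun_eq_iff)
  have d: "d \<in> degrees (Suc n)" by (auto simp: degrees_def d_def split: nat.split)
  have \<mu>d: "\<mu> \<in> maps d" using \<mu> unfolding d0 wd .
  have single: "M_single 1 0 \<mu> d = \<mu>" "\<And>a. a \<noteq> d \<Longrightarrow> M_single 1 0 \<mu> a = 0"
    unfolding M_single_def d_def by simp_all
  have in_Mg: "M_single 1 0 \<mu> \<in> Mg d"
  proof -
    have "M_single 1 0 \<mu> \<in> M"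
    proof (rule M_I[of "{d}"])
      show "support (M_single 1 0 \<mu>) \<subseteq> {d}" using single(2) by blast
      show "M_single 1 0 \<mu> a \<in> maps a" if "a \<in> degrees (Suc n)" for a
        using single \<mu>d maps_zero[OF that] by (cases "a = d") simp_all
    qed (use d in simp_all)
    then show ?thesis using single(2) by (simp add: M_component_def)
  qed
  note at = M_bracket_homogeneous[OF d d in_Mg in_Mg, unfolded single(1)]
  have double: "bracket d d \<mu> \<mu> Xs = scale 2 (circ d d \<mu> \<mu> Xs)" for Xs
    using scale_left_distrib[of 1 1] by (simp add: bracket_apply pairing_Suc d0 wd)
  have "M_bracket scale n Vg (M_single 1 0 \<mu>) (M_single 1 0 \<mu>) = 0 \<longleftrightarrow> bracket d d \<mu> \<mu> = 0"
  proof
    assume "M_bracket scale n Vg (M_single 1 0 \<mu>) (M_single 1 0 \<mu>) = 0"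
    from fun_cong[OF this, of "d + d"] show "bracket d d \<mu> \<mu> = 0"
      unfolding at by simp
  next
    assume "bracket d d \<mu> \<mu> = 0"
    then show "M_bracket scale n Vg (M_single 1 0 \<mu>) (M_single 1 0 \<mu>) = 0"
      by (intro ext) (simp add: at)
  qed
  also have "\<dots> \<longleftrightarrow> (\<forall>Xs. circ d d \<mu> \<mu> Xs = 0)"
    by (simp add: fun_eq_iff double)
  also have "\<dots> \<longleftrightarrow> (\<forall>X Y Z. \<mu> [\<mu> [X, Y], Z] = \<mu> [X, \<mu> [Y, Z]])"
  proof (intro iffI allI)
    fix X Y Z assume "\<forall>Xs. circ d d \<mu> \<mu> Xs = 0"
    then show "\<mu> [\<mu> [X, Y], Z] = \<mu> [X, \<mu> [Y, Z]]"
      using circ_self_multiplication[OF d0 wd, of \<mu> X Y Z] by simp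
  next
    fix Xs assume *: "\<forall>X Y Z. \<mu> [\<mu> [X, Y], Z] = \<mu> [X, \<mu> [Y, Z]]"
    show "circ d d \<mu> \<mu> Xs = 0"
    proof (cases "length Xs = 3")
      case True
      then obtain X Y Z where "Xs = [X, Y, Z]"
        by (auto simp: numeral_3_eq_3 length_Suc_conv)
      then show ?thesis using * circ_self_multiplication[OF d0 wd, of \<mu> X Y Z] by simp
    next
      case False
      then show ?thesis by (intro circ_wrong_length) (simp add: d0)
    qed
  qed
  also have "\<dots> \<longleftrightarrow> associative_graded_multiplication scale n Vg (\<lambda>X Y. \<mu> [X, Y])"
  proof -
    have left: "lin (\<lambda>X. \<mu> [X, Y])" and right: "lin (\<lambda>Y. \<mu> [X, Y])" for X Y
      using multilinear_slot[OF \<mu>, of "[]" "[Y]"] multilinear_slot[OF \<mu>, of "[X]" "[]"] by simp_all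
    have "\<mu> [X, Y] \<in> Vg (x + y)"
      if "x \<in> degrees n" "y \<in> degrees n" "X \<in> Vg x" "Y \<in> Vg y" for x y X Y
    proof -
      have "\<mu> [X, Y] \<in> Vg (sum_list [x, y] + 0)"
        by (rule multilinear_degree[OF \<mu>]) (use that in \<open>simp_all add: homogeneous_args_def\<close>)
      then show ?thesis by (simp only: sum_list.Cons sum_list.Nil add_0_right)
    qed
    then show ?thesis
      unfolding associative_graded_multiplication_def
      using lin_add[OF left] lin_add[OF right] lin_scale[OF left] lin_scale[OF right] by blast
  qed
  finally show ?thesis by blast
qed

end

theorem theorem2p3:
  fixes scale :: "'k::field_char_0 \<Rightarrow> 'v::ab_group_add \<Rightarrow> 'v"
    and n :: nat
    and Vg :: "(nat \<Rightarrow> int) \<Rightarrow> 'v set"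
  assumes "graded_vector_space scale n UNIV Vg"
  shows "graded_lie_algebra (M_scale scale) (Suc n) (M_space scale n Vg) (M_component scale n Vg)
           (M_bracket scale n Vg) \<and>
         (\<forall>\<mu>\<in>multilinear_maps scale n Vg 1 0.
           associative_graded_multiplication scale n Vg (\<lambda>X Y. \<mu> [X, Y]) \<longleftrightarrow>
           M_bracket scale n Vg (M_single 1 0 \<mu>) (M_single 1 0 \<mu>) = 0)"
proof -
  interpret graded_space scale n Vg by (rule graded_space.intro) (rule assms)
  show ?thesis using graded_lie_algebra_M associative_iff by blast
qed

end
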